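(* Let $0<q<1$, $0<a<q^{-1}$, $b<q^{-1}$, and let $c\in\mathbb{C}\setminus\{0\}$ be such that $\gamma=(1+abq^2)-(acq+bq/c)$ is real and $\Lambda_n^\gamma:=q^{-n}(1-acq^{n+1})(1-bq^{n+1}/c)>0$ for all $n\in\mathbb{N}$. Let $\nu$ be the measure on $q^{\mathbb{N}}=\{q^k:k\in\mathbb{N}\}$ with $\nu(\{q^k\})=w_k(a,b;q)=\frac{(qb;q)_k}{(q;q)_k}(aq)^k$, and define on functions $f:q^{\mathbb{N}}\to\mathbb{C}$ \[ (T^\gamma f)(x)=aq(bqx-1)\bigl(f(qx)-f(x)\bigr)+(x-1)\bigl(f(q^{-1}x)-f(x)\bigr)+\gamma x f(x),\qquad x\in q^{\mathbb{N}} \] (at $x=1$ the coefficient $x-1$ vanishes). Then $T^\gamma$ is a bounded self-adjoint operator on $L^2(\nu)$ with simple spectrum equal to \[ \bigl[(1-\sqrt{aq})^2,(1+\sqrt{aq})^2\bigr]\ \cup\ \bigl\{(1-q^{-k}/c)(1-acq^{1+k}): k\in\mathbb{N},\ |q^kc\sqrt{aq}|>1\bigr\} \] \[ \cup\ \bigl\{(1-bq^{l+1}/c)(1-acq^{-l}/b): l\in\mathbb{N},\ |q^l\tfrac{b}{c}\sqrt{q/a}|>1\bigr\}. \]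
   Context: $(x;q)_k=\prod_{j=0}^{k-1}(1-xq^j)$, $(x_1,\dots,x_r;q)_k=\prod_i(x_i;q)_k$, $\mathbb{N}=\{0,1,2,\dots\}$. (When $q^kc\sqrt{aq}$ etc. is required to have modulus $>1$, the corresponding parameter is real in the relevant case.) *)

theory Defs
  imports "HOL-Analysis.Analysis"
begin

definition qpoch :: "'a::comm_ring_1 \<Rightarrow> 'a \<Rightarrow> nat \<Rightarrow> 'a" where
  "qpoch x q k = (\<Prod>j<k. 1 - x * q ^ j)"

text \<open>Weights w_k(a,b;q) = (qb;q)_k/(q;q)_k (aq)^k of the measure nu on q^N;
  a function on q^N is identified with f :: nat => complex via f k = f(q^k).\<close>
definition wt :: "real \<Rightarrow> real \<Rightarrow> real \<Rightarrow> nat \<Rightarrow> real" where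
  "wt a b q k = qpoch (q * b) q k / qpoch q q k * (a * q) ^ k"

definition L2w :: "(nat \<Rightarrow> real) \<Rightarrow> (nat \<Rightarrow> complex) set" where
  "L2w w = {f. summable (\<lambda>k. w k * (cmod (f k))\<^sup>2)}"

definition norm2 :: "(nat \<Rightarrow> real) \<Rightarrow> (nat \<Rightarrow> complex) \<Rightarrow> real" where
  "norm2 w f = sqrt (\<Sum>k. w k * (cmod (f k))\<^sup>2)"

definition inner2 :: "(nat \<Rightarrow> real) \<Rightarrow> (nat \<Rightarrow> complex) \<Rightarrow> (nat \<Rightarrow> complex) \<Rightarrow> complex" where
  "inner2 w f g = (\<Sum>k. complex_of_real (w k) * f k * cnj (g k))"

text \<open>The operator T^gamma, written on the index k (x = q^k, qx = q^(k+1), x/q = q^(k-1)).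
  At k = 0 (x = 1) the coefficient x - 1 vanishes.\<close>
definition Tgam :: "real \<Rightarrow> real \<Rightarrow> real \<Rightarrow> complex \<Rightarrow> (nat \<Rightarrow> complex) \<Rightarrow> nat \<Rightarrow> complex" where
  "Tgam a b q \<gamma> f k =
     complex_of_real (a * q * (b * q ^ (k + 1) - 1)) * (f (Suc k) - f k)
     + (if k = 0 then 0 else complex_of_real (q ^ k - 1) * (f (k - 1) - f k))
     + \<gamma> * complex_of_real (q ^ k) * f k"

definition bounded_op_on :: "(nat \<Rightarrow> real) \<Rightarrow> ((nat \<Rightarrow> complex) \<Rightarrow> (nat \<Rightarrow> complex)) \<Rightarrow> bool" where
  "bounded_op_on w T \<longleftrightarrow>
     (\<forall>f\<in>L2w w. T f \<in> L2w w) \<and>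
     (\<forall>f\<in>L2w w. \<forall>g\<in>L2w w. \<forall>s t. T (\<lambda>k. s * f k + t * g k) = (\<lambda>k. s * T f k + t * T g k)) \<and>
     (\<exists>C. \<forall>f\<in>L2w w. norm2 w (T f) \<le> C * norm2 w f)"

definition self_adjoint_on :: "(nat \<Rightarrow> real) \<Rightarrow> ((nat \<Rightarrow> complex) \<Rightarrow> (nat \<Rightarrow> complex)) \<Rightarrow> bool" where
  "self_adjoint_on w T \<longleftrightarrow>
     (\<forall>f\<in>L2w w. \<forall>g\<in>L2w w. inner2 w (T f) g = inner2 w f (T g))"

definition spectrum_on :: "(nat \<Rightarrow> real) \<Rightarrow> ((nat \<Rightarrow> complex) \<Rightarrow> (nat \<Rightarrow> complex)) \<Rightarrow> complex set" where
  "spectrum_on w T = {z. \<not> (\<exists>S. bounded_op_on w S \<and>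
       (\<forall>f\<in>L2w w. S (\<lambda>k. T f k - z * f k) = f \<and> (\<lambda>k. T (S f) k - z * S f k) = f))}"

definition simple_spectrum_on :: "(nat \<Rightarrow> real) \<Rightarrow> ((nat \<Rightarrow> complex) \<Rightarrow> (nat \<Rightarrow> complex)) \<Rightarrow> bool" where
  "simple_spectrum_on w T \<longleftrightarrow>
     (\<exists>v\<in>L2w w. \<forall>f\<in>L2w w. \<forall>e>0. \<exists>N c.
        norm2 w (\<lambda>k. f k - (\<Sum>n<N. c n * (T ^^ n) v k)) < e)"

end

theory Submission
  imports Defs
begin

text \<open>
  Put \<open>A = acq\<close> and \<open>B = bq/c\<close>, and write the spectral parameter as
  \<open>z = (1 - s) (1 - aq/s)\<close>. At infinity the recurrence \<open>T f = z f\<close> has the solutions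
  \<open>f k \<sim> s\<^sup>-\<^sup>k\<close> and \<open>f k \<sim> (s/aq)\<^sup>k\<close>. If \<open>|s| = sqrt (aq)\<close>, both just fail to be square integrable
  and truncations of \<open>s\<^sup>-\<^sup>k\<close> form a Weyl sequence; this is the interval. If \<open>|s| > sqrt (aq)\<close>, the
  decaying solution is an explicit basic hypergeometric series \<open>\<psi>\<close>, and it satisfies the equation
  up to a multiple \<open>s D\<close> of the point mass at \<open>0\<close>, where \<open>D\<close> is a nonzero multiple of the infinite
  product \<open>(A/s, B/s; q)\<close>. If \<open>D \<noteq> 0\<close>, the resolvent is the Green operator built from \<open>\<psi>\<close> and the
  polynomial solution, whose kernel is bounded by a geometric Toeplitz kernel. If \<open>D = 0\<close>, then
  \<open>s = A q\<^sup>k\<close> or \<open>s = B q\<^sup>k\<close>, and there is an eigenvector of the form \<open>A\<^sup>-\<^sup>n\<close>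
  (respectively \<open>B\<^sup>-\<^sup>n\<close>) times a polynomial of degree \<open>k\<close> in \<open>q\<^sup>-\<^sup>n\<close>.
\<close>

subsection \<open>Convergence of q-shifted factorials and weighted square summability\<close>

lemma convergent_prod_one_minus_geometric:
  fixes x q :: "'a :: {real_normed_field, banach}"
  assumes "norm q < 1"
  shows "convergent_prod (\<lambda>j. 1 - x * q ^ j)"
proof -
  have "summable (\<lambda>j. norm x * norm q ^ j)"
    using assms by (intro summable_mult summable_geometric) auto
  then have "abs_convergent_prod (\<lambda>j. 1 - x * q ^ j)"
    by (intro summable_imp_abs_convergent_prod) (simp add: norm_mult norm_power)
  then show ?thesis
    by (rule abs_convergent_prod_imp_convergent_prod)
qed

text \<open>A convergent product in the sense of \<open>convergent_prod\<close> has limit zero only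
  if one of its factors is zero. This criterion later turns \<open>D = 0\<close> into the discrete
  condition on \<open>s\<close>.\<close>

lemma qpoch_LIMSEQ:
  fixes x q :: "'a :: {real_normed_field, banach}"
  assumes "norm q < 1"
  obtains L where "qpoch x q \<longlonglongrightarrow> L" "L = 0 \<longleftrightarrow> (\<exists>j. x * q ^ j = 1)"
proof
  let ?f = "\<lambda>j. 1 - x * q ^ j"
  note conv = convergent_prod_one_minus_geometric[OF assms, of x]
  show "qpoch x q \<longlonglongrightarrow> prodinf ?f"
    using convergent_prod_LIMSEQ[OF conv]
    by (simp add: qpoch_def[abs_def] LIMSEQ_lessThan_iff_atMost)
  have "prodinf ?f = 0 \<longleftrightarrow> (\<exists>j. ?f j = 0)"
  proof
    assume "prodinf ?f = 0"
    then show "\<exists>j. ?f j = 0"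
      using prodinf_nonzero[OF conv] by blast
  next
    assume "\<exists>j. ?f j = 0"
    then have "(\<lambda>n. \<Prod>j\<le>n. ?f j) \<longlonglongrightarrow> 0"
      by (rule convergent_prod_to_zero_iff[OF conv, THEN iffD2])
    then show "prodinf ?f = 0"
      by (rule LIMSEQ_unique[OF convergent_prod_LIMSEQ[OF conv]])
  qed
  also have "\<dots> \<longleftrightarrow> (\<exists>j. x * q ^ j = 1)"
    by (metis right_minus_eq)
  finally show "prodinf ?f = 0 \<longleftrightarrow> (\<exists>j. x * q ^ j = 1)" .
qed

lemma qpoch_Suc: "qpoch x q (Suc k) = qpoch x q k * (1 - x * q ^ k)"
  by (simp add: qpoch_def)

lemma qpoch_0 [simp]: "qpoch x q 0 = 1"
  by (simp add: qpoch_def)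

lemma qpoch_pos:
  fixes x q :: real
  assumes "0 < q" "q < 1" "x < 1"
  shows "0 < qpoch x q k"
  unfolding qpoch_def
proof (rule prod_pos)
  fix j
  have "x * q ^ j < 1"
  proof (cases "x \<le> 0")
    case True
    then have "x * q ^ j \<le> 0"
      using assms by (simp add: mult_nonpos_nonneg)
    then show ?thesis by simp
  next
    case False
    then have "x * q ^ j \<le> x * 1"
      using assms by (intro mult_left_mono power_le_one) auto
    then show ?thesis using assms by simp
  qed
  then show "0 < 1 - x * q ^ j" by simp
qed

text \<open>The partial products are positive and tend to a nonzero limit, so they and their
  inverses are bounded sequences.\<close>

lemma qpoch_bounds:
  fixes x q :: real
  assumes "0 < q" "q < 1" "x < 1"
  obtains l u where "0 < l" "\<And>k. l \<le> qpoch x q k" "\<And>k. qpoch x q k \<le> u"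
proof -
  obtain L where L: "qpoch x q \<longlonglongrightarrow> L" "L = 0 \<longleftrightarrow> (\<exists>j. x * q ^ j = 1)"
    using qpoch_LIMSEQ[of q x] assms by auto
  note pos = qpoch_pos[OF assms]
  have "x * q ^ j \<noteq> 1" for j
    using pos[of "Suc j"] pos[of j] by (auto simp: qpoch_Suc)
  with L have "L \<noteq> 0" by auto
  then have "(\<lambda>k. inverse (qpoch x q k)) \<longlonglongrightarrow> inverse L"
    by (intro tendsto_inverse L)
  then have "Bseq (\<lambda>k. inverse (qpoch x q k))"
    by (intro convergent_imp_Bseq convergentI)
  then obtain K where K: "K > 0" "\<And>k. norm (inverse (qpoch x q k)) \<le> K"
    by (auto simp: Bseq_def)
  have "Bseq (qpoch x q)"
    using L by (intro convergent_imp_Bseq convergentI)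
  then obtain u where u: "\<And>k. norm (qpoch x q k) \<le> u"
    by (auto simp: Bseq_def)
  show ?thesis
  proof
    show "0 < inverse K" using K by simp
    show "inverse K \<le> qpoch x q k" for k
      using K(2)[of k] pos[of k] K(1) by (simp add: field_simps)
    show "qpoch x q k \<le> u" for k
      using u[of k] by simp
  qed
qed

section \<open>Weighted square summability through finite sections\<close>

lemma L2_set_sqrt_weight:
  assumes "\<And>k. 0 \<le> w k"
  shows "L2_set (\<lambda>k. sqrt (w k) * cmod (f k)) {..<N} = sqrt (\<Sum>k<N. w k * (cmod (f k))\<^sup>2)"
  using assms by (simp add: L2_set_def power_mult_distrib)

text \<open>Bounds on finite sections, uniform in \<open>N\<close>, give membership and the norm
  bound at once; Minkowski's inequality is then only needed for finite sums.\<close>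

lemma L2w_I:
  assumes w: "\<And>k. 0 \<le> w k"
    and M: "\<And>N. L2_set (\<lambda>k. sqrt (w k) * cmod (f k)) {..<N} \<le> M"
  shows "f \<in> L2w w" "norm2 w f \<le> M"
proof -
  have M0: "0 \<le> M"
    using M[of 0] by simp
  have *: "(\<Sum>k<N. w k * (cmod (f k))\<^sup>2) \<le> M\<^sup>2" for N
    using M[of N] M0 by (simp add: L2_set_sqrt_weight[OF w] sqrt_le_D)
  have s: "summable (\<lambda>k. w k * (cmod (f k))\<^sup>2)"
    by (rule summableI_nonneg_bounded[OF _ *]) (use w in auto)
  then show "f \<in> L2w w"
    by (simp add: L2w_def)
  have "(\<Sum>k. w k * (cmod (f k))\<^sup>2) \<le> M\<^sup>2"
    by (rule suminf_le_const[OF s *])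
  then show "norm2 w f \<le> M"
    unfolding norm2_def using M0 by (simp add: real_le_lsqrt)
qed

lemma L2_set_le_norm2:
  assumes w: "\<And>k. 0 \<le> w k" and f: "f \<in> L2w w"
  shows "L2_set (\<lambda>k. sqrt (w k) * cmod (f k)) {..<N} \<le> norm2 w f"
proof -
  have "(\<Sum>k<N. w k * (cmod (f k))\<^sup>2) \<le> (\<Sum>k. w k * (cmod (f k))\<^sup>2)"
    by (rule sum_le_suminf) (use f w in \<open>auto simp: L2w_def\<close>)
  then show ?thesis
    by (simp add: L2_set_sqrt_weight[OF w] norm2_def)
qed

lemma L2w_component_le:
  assumes w: "\<And>k. 0 \<le> w k" and f: "f \<in> L2w w"
  shows "sqrt (w k) * cmod (f k) \<le> norm2 w f"
proof -
  have "sqrt (w k) * cmod (f k) \<le> L2_set (\<lambda>k. sqrt (w k) * cmod (f k)) {..<Suc k}"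
    using member_le_L2_set[of "{..<Suc k}" k "\<lambda>k. sqrt (w k) * cmod (f k)"] by simp
  also have "\<dots> \<le> norm2 w f"
    by (rule L2_set_le_norm2[OF assms])
  finally show ?thesis .
qed

lemma L2w_component_tendsto_0:
  assumes w: "\<And>k. 0 \<le> w k" and f: "f \<in> L2w w"
  shows "(\<lambda>k. sqrt (w k) * cmod (f k)) \<longlonglongrightarrow> 0"
proof -
  have "(\<lambda>k. w k * (cmod (f k))\<^sup>2) \<longlonglongrightarrow> 0"
    using f by (simp add: L2w_def summable_LIMSEQ_zero)
  then have "(\<lambda>k. sqrt (w k * (cmod (f k))\<^sup>2)) \<longlonglongrightarrow> sqrt 0"
    by (rule tendsto_real_sqrt)
  then show ?thesis
    by (simp add: real_sqrt_mult)
qed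

lemma norm2_nonneg:
  assumes w: "\<And>k. 0 \<le> w k" and f: "f \<in> L2w w"
  shows "0 \<le> norm2 w f"
  using L2_set_le_norm2[OF assms, of 0] by simp

lemma L2w_add:
  assumes w: "\<And>k. 0 \<le> w k" and f: "f \<in> L2w w" and g: "g \<in> L2w w"
  shows "(\<lambda>k. f k + g k) \<in> L2w w" "norm2 w (\<lambda>k. f k + g k) \<le> norm2 w f + norm2 w g"
proof -
  have "L2_set (\<lambda>k. sqrt (w k) * cmod (f k + g k)) {..<N} \<le> norm2 w f + norm2 w g" for N
  proof -
    have "L2_set (\<lambda>k. sqrt (w k) * cmod (f k + g k)) {..<N} \<le>
        L2_set (\<lambda>k. sqrt (w k) * cmod (f k) + sqrt (w k) * cmod (g k)) {..<N}"
      using w by (intro L2_set_mono) (auto simp flip: distrib_left intro!: mult_left_mono norm_triangle_ineq)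
    also have "\<dots> \<le> L2_set (\<lambda>k. sqrt (w k) * cmod (f k)) {..<N}
        + L2_set (\<lambda>k. sqrt (w k) * cmod (g k)) {..<N}"
      by (rule L2_set_triangle_ineq)
    also have "\<dots> \<le> norm2 w f + norm2 w g"
      by (intro add_mono L2_set_le_norm2 assms)
    finally show ?thesis .
  qed
  from L2w_I[OF w this] show "(\<lambda>k. f k + g k) \<in> L2w w"
    "norm2 w (\<lambda>k. f k + g k) \<le> norm2 w f + norm2 w g" by auto
qed

lemma L2w_cmult:
  assumes w: "\<And>k. 0 \<le> w k" and f: "f \<in> L2w w"
  shows "(\<lambda>k. c * f k) \<in> L2w w" "norm2 w (\<lambda>k. c * f k) \<le> cmod c * norm2 w f"
proof -
  have "L2_set (\<lambda>k. sqrt (w k) * cmod (c * f k)) {..<N} \<le> cmod c * norm2 w f" for N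
  proof -
    have "L2_set (\<lambda>k. sqrt (w k) * cmod (c * f k)) {..<N} =
        cmod c * L2_set (\<lambda>k. sqrt (w k) * cmod (f k)) {..<N}"
      by (simp add: L2_set_right_distrib norm_mult mult_ac)
    also have "\<dots> \<le> cmod c * norm2 w f"
      by (intro mult_left_mono L2_set_le_norm2 assms) auto
    finally show ?thesis .
  qed
  from L2w_I[OF w this] show "(\<lambda>k. c * f k) \<in> L2w w"
    "norm2 w (\<lambda>k. c * f k) \<le> cmod c * norm2 w f" by auto
qed

lemma L2w_finite_support:
  assumes "\<And>k. N \<le> k \<Longrightarrow> f k = 0"
  shows "f \<in> L2w w" "norm2 w f = sqrt (\<Sum>k<N. w k * (cmod (f k))\<^sup>2)"
proof -
  have "(\<lambda>k. w k * (cmod (f k))\<^sup>2) sums (\<Sum>k<N. w k * (cmod (f k))\<^sup>2)"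
    by (rule sums_finite) (use assms in \<open>auto simp: not_less\<close>)
  then show "f \<in> L2w w" "norm2 w f = sqrt (\<Sum>k<N. w k * (cmod (f k))\<^sup>2)"
    by (auto simp: L2w_def norm2_def sums_iff)
qed

lemma inner2_summable:
  assumes w: "\<And>k. 0 \<le> w k" and f: "f \<in> L2w w" and g: "g \<in> L2w w"
  shows "summable (\<lambda>k. w k * (cmod (f k) * cmod (g k)))"
proof (rule summable_comparison_test'[where N = 0])
  show "summable (\<lambda>k. w k * (cmod (f k))\<^sup>2 + w k * (cmod (g k))\<^sup>2)"
    using f g unfolding L2w_def by (intro summable_add) simp_all
  fix k :: nat
  have "cmod (f k) * cmod (g k) \<le> (cmod (f k))\<^sup>2 + (cmod (g k))\<^sup>2"
  proof -
    have "0 \<le> cmod (f k) * cmod (g k)" by simp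
    moreover have "2 * (cmod (f k) * cmod (g k)) \<le> (cmod (f k))\<^sup>2 + (cmod (g k))\<^sup>2"
      using sum_squares_bound[of "cmod (f k)" "cmod (g k)"] by (simp only: mult.assoc)
    ultimately show ?thesis by linarith
  qed
  then have "w k * (cmod (f k) * cmod (g k)) \<le> w k * ((cmod (f k))\<^sup>2 + (cmod (g k))\<^sup>2)"
    by (intro mult_left_mono w)
  moreover have "0 \<le> w k * (cmod (f k) * cmod (g k))"
    by (intro mult_nonneg_nonneg w) auto
  ultimately show "norm (w k * (cmod (f k) * cmod (g k))) \<le> w k * (cmod (f k))\<^sup>2 + w k * (cmod (g k))\<^sup>2"
    by (simp only: real_norm_def abs_of_nonneg distrib_left)
qed

lemma inner2_sums:
  assumes w: "\<And>k. 0 \<le> w k" and f: "f \<in> L2w w" and g: "g \<in> L2w w"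
  shows "(\<lambda>k. complex_of_real (w k) * f k * cnj (g k)) sums inner2 w f g"
proof -
  have "summable (\<lambda>k. complex_of_real (w k) * f k * cnj (g k))"
    by (rule summable_norm_cancel)
      (use inner2_summable[OF assms] w in \<open>simp add: norm_mult mult.assoc\<close>)
  then show ?thesis
    unfolding inner2_def by (rule summable_sums)
qed

section \<open>Shifts and first-order recurrences in \<open>L2_set\<close>\<close>

lemma L2_set_Suc_shift_le:
  "L2_set (\<lambda>k. h (Suc k)) {..<N} \<le> L2_set h {..<Suc N}"
proof -
  have "(\<Sum>k<Suc N. (h k)\<^sup>2) = (h 0)\<^sup>2 + (\<Sum>k<N. (h (Suc k))\<^sup>2)"
    by (rule sum.lessThan_Suc_shift)
  then show ?thesis
    by (simp add: L2_set_def)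
qed

lemma L2_set_pred_shift_le:
  assumes "g 0 = 0" "\<And>k. g (Suc k) = h k"
  shows "L2_set g {..<N} \<le> L2_set h {..<N}"
proof (cases N)
  case (Suc M)
  have "(\<Sum>k<Suc M. (g k)\<^sup>2) = (g 0)\<^sup>2 + (\<Sum>k<M. (g (Suc k))\<^sup>2)"
    by (rule sum.lessThan_Suc_shift)
  also have "\<dots> = (\<Sum>k<M. (h k)\<^sup>2)"
    using assms by simp
  also have "\<dots> \<le> (\<Sum>k<Suc M. (h k)\<^sup>2)"
    by simp
  finally show ?thesis
    unfolding L2_set_def Suc by (rule real_sqrt_le_mono)
qed simp

text \<open>Minkowski applied to \<open>u (n + 1) = r * u n + h (n + 1)\<close>: the sequence is bounded by
  \<open>r\<close> times a shift of itself plus \<open>h\<close>.\<close>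

lemma L2_set_forward_recurrence_le:
  fixes u h :: "nat \<Rightarrow> real"
  assumes r: "0 \<le> r" "r < 1" and u: "\<And>n. 0 \<le> u n" and h: "\<And>n. 0 \<le> h n"
    and "u 0 = h 0" and rec: "\<And>n. u (Suc n) = r * u n + h (Suc n)"
  shows "L2_set u {..<N} \<le> L2_set h {..<N} / (1 - r)"
proof -
  define v where "v n = (case n of 0 \<Rightarrow> 0 | Suc m \<Rightarrow> r * u m)" for n
  have "L2_set u {..<N} = L2_set (\<lambda>n. v n + h n) {..<N}"
    by (intro L2_set_cong refl) (use assms in \<open>auto simp: v_def split: nat.split\<close>)
  also have "\<dots> \<le> L2_set v {..<N} + L2_set h {..<N}"
    by (rule L2_set_triangle_ineq)
  also have "L2_set v {..<N} \<le> L2_set (\<lambda>n. r * u n) {..<N}"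
    by (rule L2_set_pred_shift_le) (auto simp: v_def)
  also have "\<dots> = r * L2_set u {..<N}"
    using r by (simp add: L2_set_right_distrib)
  finally have "(1 - r) * L2_set u {..<N} \<le> L2_set h {..<N}"
    by (simp add: algebra_simps)
  then show ?thesis
    using r by (simp add: field_simps)
qed

text \<open>The same absorption argument with the shift going up. The shift now reaches one index
  beyond the section, and the a priori bound \<open>V\<close> pays for the extra term
  \<open>v N\<close>.\<close>

lemma L2_set_backward_recurrence_le:
  fixes v h :: "nat \<Rightarrow> real"
  assumes r: "0 \<le> r" "r < 1" and v: "\<And>n. 0 \<le> v n" "\<And>n. v n \<le> V" and h: "\<And>n. 0 \<le> h n"
    and H: "\<And>N. L2_set h {..<N} \<le> H"
    and rec: "\<And>n. v n = r * (v (Suc n) + h (Suc n))"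
  shows "L2_set v {..<N} \<le> (V + H) / (1 - r)"
proof -
  have H0: "0 \<le> H" using H[of 0] by simp
  have V0: "0 \<le> V" using v[of 0] by linarith
  have "L2_set v {..<N} = r * L2_set (\<lambda>n. v (Suc n) + h (Suc n)) {..<N}"
    unfolding L2_set_right_distrib[OF r(1)] by (intro L2_set_cong refl rec)
  also have "\<dots> \<le> r * (L2_set (\<lambda>n. v (Suc n)) {..<N} + L2_set (\<lambda>n. h (Suc n)) {..<N})"
    by (intro mult_left_mono L2_set_triangle_ineq r)
  also have "L2_set (\<lambda>n. v (Suc n)) {..<N} \<le> L2_set v {..<Suc N}"
    by (rule L2_set_Suc_shift_le)
  also have "L2_set v {..<Suc N} \<le> v N + L2_set v {..<N}"
    using v(1)[of N] by (simp add: lessThan_Suc sqrt_sum_squares_le_sum)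
  also have "v N \<le> V" by (rule v)
  also have "L2_set (\<lambda>n. h (Suc n)) {..<N} \<le> L2_set h {..<Suc N}"
    by (rule L2_set_Suc_shift_le)
  also have "\<dots> \<le> H" by (rule H)
  finally have "L2_set v {..<N} \<le> r * (V + L2_set v {..<N} + H)"
    using r by (simp add: mult_left_mono)
  then have "(1 - r) * L2_set v {..<N} \<le> r * (V + H)"
    by (simp add: algebra_simps)
  also have "\<dots> \<le> 1 * (V + H)"
    using r V0 H0 by (intro mult_right_mono) auto
  finally show ?thesis
    using r by (simp add: field_simps)
qed

text \<open>The growth factors multiply up to \<open>qpoch (- C) q n\<close>, a partial product of a
  convergent infinite product.\<close>

lemma discrete_gronwall_geometric:
  fixes N :: "nat \<Rightarrow> real"
  assumes q: "0 < q" "q < 1" and C: "0 \<le> C" and N0: "\<And>n. 0 \<le> N n"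
    and step: "\<And>n. N (Suc n) \<le> (1 + C * q ^ n) * N n"
  obtains M where "\<And>n. N n \<le> M"
proof -
  obtain l u where u: "\<And>k. qpoch (- C) q k \<le> u"
    using qpoch_bounds[of q "- C"] q C by force
  have "N n \<le> qpoch (- C) q n * N 0" for n
  proof (induction n)
    case (Suc n)
    have "N (Suc n) \<le> (1 + C * q ^ n) * N n" by (rule step)
    also have "\<dots> \<le> (1 + C * q ^ n) * (qpoch (- C) q n * N 0)"
      using C q by (intro mult_left_mono Suc) auto
    finally show ?case by (simp add: qpoch_Suc mult_ac)
  qed simp
  also have "qpoch (- C) q n * N 0 \<le> u * N 0" for n
    by (intro mult_right_mono u N0)
  finally show ?thesis using that by blast
qed

subsection \<open>The operator as a bounded self-adjoint Jacobi operator\<close>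

text \<open>\<open>A\<close> and \<open>B\<close> stand for \<open>acq\<close> and \<open>bq/c\<close>; up to scaling the recurrence is that of the
  Al-Salam--Chihara polynomials with parameters \<open>A / sqrt (aq)\<close> and \<open>B / sqrt (aq)\<close>.\<close>

locale q_jacobi =
  fixes q a b :: real and A B \<gamma> :: complex
  assumes q: "0 < q" "q < 1" and a: "0 < a" "a * q < 1" and b: "q * b < 1"
    and AB: "A * B = complex_of_real (a * b * q\<^sup>2)"
    and \<gamma>: "\<gamma> = (1 + complex_of_real (a * b * q\<^sup>2)) - (A + B)"
    and \<gamma>_real: "Im \<gamma> = 0"
begin

abbreviation "w \<equiv> wt a b q"
abbreviation "T \<equiv> Tgam a b q \<gamma>"

text \<open>Minus the coefficient of \<open>f (Suc k)\<close> in \<open>Tgam\<close>; with this sign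
  it is positive.\<close>

definition up :: "nat \<Rightarrow> real" where
  "up k = a * q * (1 - b * q ^ Suc k)"

lemma pow_le_1: "q ^ k \<le> 1" and pow_pos: "0 < q ^ k"
  using q by (auto intro: power_le_one)

lemma pow_Suc_less_1: "q ^ Suc k < 1"
  by (rule power_Suc_less_one) (use q in auto)

lemma up_pos: "0 < up k"
proof -
  have "0 < qpoch (q * b) q (Suc k)" "0 < qpoch (q * b) q k"
    using qpoch_pos q b by blast+
  then have "0 < 1 - q * b * q ^ k"
    by (simp add: qpoch_Suc zero_less_mult_iff)
  then show ?thesis
    using a q by (simp add: up_def mult_ac)
qed

lemma up_le: "up k \<le> a * q * (1 + \<bar>b\<bar>)"
proof -
  have "\<bar>b * q ^ Suc k\<bar> \<le> \<bar>b\<bar> * 1"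
    unfolding abs_mult using q pow_le_1[of "Suc k"] by (intro mult_left_mono) auto
  then have "1 - b * q ^ Suc k \<le> 1 + \<bar>b\<bar>" by simp
  then show ?thesis
    unfolding up_def using a q by (intro mult_left_mono) auto
qed

lemma w_pos: "0 < w k"
  using q a b qpoch_pos[of q "q * b" k] qpoch_pos[of q q k] by (simp add: wt_def)

lemma w_nonneg: "0 \<le> w k"
  using w_pos[of k] by simp

lemma w_0: "w 0 = 1"
  by (simp add: wt_def)

text \<open>Detailed balance between neighbouring indices: it makes \<open>T\<close> symmetric for
  the weight \<open>w\<close> and the weighted Wronskian below constant.\<close>

lemma w_Suc: "w (Suc k) * (1 - q ^ Suc k) = w k * up k"
proof -
  have "qpoch q q k \<noteq> 0" "1 - q ^ Suc k \<noteq> 0"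
    using qpoch_pos[of q q k] q pow_Suc_less_1[of k] by auto
  then show ?thesis
    by (simp add: wt_def qpoch_Suc up_def divide_simps mult_ac)
qed

lemma w_bounds:
  obtains l u where "0 < l" "0 < u" "\<And>k. l * (a * q) ^ k \<le> w k" "\<And>k. w k \<le> u * (a * q) ^ k"
proof -
  obtain l1 u1 where 1: "0 < l1" "\<And>k. l1 \<le> qpoch (q * b) q k" "\<And>k. qpoch (q * b) q k \<le> u1"
    using qpoch_bounds q b by metis
  obtain l2 u2 where 2: "0 < l2" "\<And>k. l2 \<le> qpoch q q k" "\<And>k. qpoch q q k \<le> u2"
    using qpoch_bounds q by metis
  have u: "0 < u1" "0 < u2"
    using 1(1) 1(2,3)[of 0] 2(1) 2(2,3)[of 0] by linarith+
  show ?thesis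
  proof
    show "0 < l1 / u2" "0 < u1 / l2" using u 1 2 by auto
    fix k
    have "l1 / u2 \<le> qpoch (q * b) q k / qpoch q q k"
      using 1 2 u qpoch_pos[of q q k] q qpoch_pos[of q "q * b" k] b by (intro frac_le) auto
    then show "l1 / u2 * (a * q) ^ k \<le> w k"
      unfolding wt_def using a q by (intro mult_right_mono) auto
    have "qpoch (q * b) q k / qpoch q q k \<le> u1 / l2"
      using 1 2 u qpoch_pos[of q q k] q qpoch_pos[of q "q * b" k] b by (intro frac_le) auto
    then show "w k \<le> u1 / l2 * (a * q) ^ k"
      unfolding wt_def using a q by (intro mult_right_mono) auto
  qed
qed

text \<open>Since \<open>sqrt (w k)\<close> is comparable with \<open>sqrt (a * q) ^ k\<close>, the
  circle of radius \<open>sqrt (a * q)\<close> is where \<open>(1 / s) ^ k\<close> stops being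
  square summable.\<close>

lemma sqrt_w_bounds:
  obtains l u where "0 < l" "0 < u" "\<And>k. l * sqrt (a * q) ^ k \<le> sqrt (w k)"
    "\<And>k. sqrt (w k) \<le> u * sqrt (a * q) ^ k"
proof -
  obtain l u where *: "0 < l" "0 < u" "\<And>k. l * (a * q) ^ k \<le> w k" "\<And>k. w k \<le> u * (a * q) ^ k"
    using w_bounds by metis
  have sq: "sqrt (m * (a * q) ^ k) = sqrt m * sqrt (a * q) ^ k" for m k
    by (simp add: real_sqrt_mult real_sqrt_power)
  show ?thesis
  proof
    show "0 < sqrt l" "0 < sqrt u" using * by auto
    show "sqrt l * sqrt (a * q) ^ k \<le> sqrt (w k)" for k
      using real_sqrt_le_mono[OF *(3)[of k]] by (simp only: sq)
    show "sqrt (w k) \<le> sqrt u * sqrt (a * q) ^ k" for k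
      using real_sqrt_le_mono[OF *(4)[of k]] by (simp only: sq)
  qed
qed

text \<open>The subtracted value is \<open>(1 - s) * (1 - a * q / s)\<close>. Up to terms of order
  \<open>q ^ k\<close>, the right side is the constant-coefficient recurrence with characteristic
  roots \<open>1 / s\<close> and \<open>s / (a * q)\<close>.\<close>

lemma T_eq:
  assumes "s \<noteq> 0"
  shows "T f k - (1 + of_real (a * q) - s - of_real (a * q) / s) * f k =
    (s + of_real (a * q) / s - of_real (q ^ k) * (A + B)) * f k
      - of_real (up k) * f (Suc k) - of_real (1 - q ^ k) * f (k - 1)"
proof -
  \<comment> \<open>The case distinction of \<open>Tgam\<close> disappears: at \<open>k = 0\<close>
    the coefficient \<open>q ^ 0 - 1\<close> vanishes, whatever \<open>f (0 - 1)\<close> is.\<close>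
  have "T f k = of_real (a * q * (b * q ^ (k + 1) - 1)) * (f (Suc k) - f k)
     + of_real (q ^ k - 1) * (f (k - 1) - f k) + \<gamma> * of_real (q ^ k) * f k"
    by (simp add: Tgam_def)
  then show ?thesis
    unfolding \<gamma> up_def by (simp add: algebra_simps power2_eq_square)
qed

lemma T_eq':
  "T f k = of_real (1 + a * q) * f k - of_real (q ^ k) * (A + B) * f k
      - of_real (up k) * f (Suc k) - of_real (1 - q ^ k) * f (k - 1)"
  \<comment> \<open>At \<open>s = 1\<close> the spectral parameter is zero.\<close>
  using T_eq[of 1 f k] by (simp add: algebra_simps)

lemma T_linear: "T (\<lambda>k. s * f k + t * g k) = (\<lambda>k. s * T f k + t * T g k)"
  unfolding T_eq' by (simp add: algebra_simps fun_eq_iff)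

lemma AB_real: "Im (A + B) = 0"
  using \<gamma>_real by (simp add: \<gamma>)

lemma cnj_AB: "cnj (A + B) = A + B"
  using AB_real by (simp add: complex_eq_iff)

text \<open>\<open>A\<close> and \<open>B\<close> may be nonreal, but besides real coefficients only
  their sum enters, and it is real because \<gamma> is.\<close>

lemma T_cnj: "T (\<lambda>k. cnj (f k)) k = cnj (T f k)"
  unfolding T_eq' using cnj_AB by simp

text \<open>After squaring, \<open>w_Suc\<close> trades \<open>w k * up k\<close> for a multiple of
  \<open>w (Suc k)\<close>. Thus the off-diagonal entries stay bounded after conjugation by
  \<open>sqrt (w k)\<close>.\<close>

lemma sqrt_w_up: "sqrt (w k) * up k \<le> sqrt (a * q * (1 + \<bar>b\<bar>)) * sqrt (w (Suc k))"
proof -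
  have "(sqrt (w k) * up k)\<^sup>2 = (w k * up k) * up k"
    using w_nonneg[of k] by (simp add: power_mult_distrib power2_eq_square)
  also have "\<dots> = w (Suc k) * (1 - q ^ Suc k) * up k"
    by (simp only: w_Suc)
  also have "\<dots> \<le> w (Suc k) * 1 * (a * q * (1 + \<bar>b\<bar>))"
    using pow_pos[of "Suc k"] w_nonneg up_pos[of k] up_le[of k] pow_Suc_less_1[of k]
    by (intro mult_mono mult_nonneg_nonneg) auto
  finally have "(sqrt (w k) * up k)\<^sup>2 \<le> a * q * (1 + \<bar>b\<bar>) * w (Suc k)"
    by (simp add: mult_ac)
  then have "\<bar>sqrt (w k) * up k\<bar> \<le> sqrt (a * q * (1 + \<bar>b\<bar>) * w (Suc k))"
    by (rule real_le_rsqrt[of "\<bar>_\<bar>", unfolded power2_abs])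
  then show ?thesis
    by (simp add: real_sqrt_mult)
qed

lemma sqrt_w_down: "sqrt (w (Suc k)) * (1 - q ^ Suc k) \<le> sqrt (a * q * (1 + \<bar>b\<bar>)) * sqrt (w k)"
proof -
  have "(sqrt (w (Suc k)) * (1 - q ^ Suc k))\<^sup>2 = w (Suc k) * (1 - q ^ Suc k) * (1 - q ^ Suc k)"
    using w_nonneg[of "Suc k"] by (simp add: power_mult_distrib power2_eq_square)
  also have "\<dots> = w k * up k * (1 - q ^ Suc k)"
    by (simp only: w_Suc)
  also have "\<dots> \<le> w k * (a * q * (1 + \<bar>b\<bar>)) * 1"
    using pow_pos[of "Suc k"] w_nonneg up_pos[of k] up_le[of k] pow_Suc_less_1[of k] q a
    by (intro mult_mono mult_nonneg_nonneg) (auto intro: less_imp_le)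
  finally have "(sqrt (w (Suc k)) * (1 - q ^ Suc k))\<^sup>2 \<le> a * q * (1 + \<bar>b\<bar>) * w k"
    by (simp add: mult_ac)
  then have "\<bar>sqrt (w (Suc k)) * (1 - q ^ Suc k)\<bar> \<le> sqrt (a * q * (1 + \<bar>b\<bar>) * w k)"
    by (rule real_le_rsqrt[of "\<bar>_\<bar>", unfolded power2_abs])
  then show ?thesis
    by (simp add: real_sqrt_mult)
qed

text \<open>In terms of \<open>sqrt (w k) * cmod (f k)\<close> the operator is dominated by a
  diagonal with bound \<open>D\<close> and two shifts with bound \<open>E\<close>.\<close>

lemma T_bounded:
  obtains C where "\<And>f. f \<in> L2w w \<Longrightarrow> T f \<in> L2w w \<and> norm2 w (T f) \<le> C * norm2 w f"
proof -
  define D where "D = 1 + a * q + cmod (A + B)"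
  define E where "E = sqrt (a * q * (1 + \<bar>b\<bar>))"
  have DE: "0 \<le> D" "0 \<le> E" using a q by (auto simp: D_def E_def)
  have main: "L2_set (\<lambda>k. sqrt (w k) * cmod (T f k)) {..<N} \<le> (D + E + E) * norm2 w f"
    if f: "f \<in> L2w w" for f N
  proof -
    define h where "h = (\<lambda>k. sqrt (w k) * cmod (f k))"
    define g where "g k = sqrt (w k) * ((1 - q ^ k) * cmod (f (k - 1)))" for k
    have h0: "0 \<le> h k" for k using w_nonneg by (simp add: h_def)
    have g0: "0 \<le> g k" for k using w_nonneg pow_le_1 by (simp add: g_def)
    have hN: "L2_set h {..<N} \<le> norm2 w f" for N
      unfolding h_def using w_nonneg f by (rule L2_set_le_norm2)
    have pt: "sqrt (w k) * cmod (T f k) \<le> D * h k + (E * h (Suc k) + g k)" for k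
    proof -
      have "cmod (T f k) \<le> cmod (of_real (1 + a * q) * f k - of_real (q ^ k) * (A + B) * f k)
          + up k * cmod (f (Suc k)) + (1 - q ^ k) * cmod (f (k - 1))"
      proof -
        have "cmod (x - of_real (up k) * y - of_real (1 - q ^ k) * z) \<le>
            cmod x + up k * cmod y + (1 - q ^ k) * cmod z" for x y z
          using norm_triangle_ineq4[of "x - of_real (up k) * y" "of_real (1 - q ^ k) * z"]
            norm_triangle_ineq4[of x "of_real (up k) * y"] up_pos[of k] pow_le_1[of k]
          unfolding norm_mult norm_of_real by simp
        then show ?thesis
          unfolding T_eq' .
      qed
      also have "cmod (of_real (1 + a * q) * f k - of_real (q ^ k) * (A + B) * f k) \<le> D * cmod (f k)"
      proof -
        have "cmod (of_real (1 + a * q) - of_real (q ^ k) * (A + B)) \<le>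
            cmod (of_real (1 + a * q)) + cmod (of_real (q ^ k) * (A + B))"
          by (rule norm_triangle_ineq4)
        also have "cmod (of_real (q ^ k) * (A + B)) \<le> 1 * cmod (A + B)"
          unfolding norm_mult norm_of_real using q pow_le_1[of k] by (intro mult_right_mono) auto
        also have "cmod (of_real (1 + a * q)) = 1 + a * q"
          unfolding norm_of_real using q a by simp
        finally have "cmod (of_real (1 + a * q) - of_real (q ^ k) * (A + B)) \<le> D"
          by (simp add: D_def)
        then have "cmod ((of_real (1 + a * q) - of_real (q ^ k) * (A + B)) * f k) \<le> D * cmod (f k)"
          unfolding norm_mult by (intro mult_right_mono) auto
        then show ?thesis by (simp only: left_diff_distrib)
      qed
      finally have "sqrt (w k) * cmod (T f k) \<le> sqrt (w k) *
         (D * cmod (f k) + up k * cmod (f (Suc k)) + (1 - q ^ k) * cmod (f (k - 1)))"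
        using w_nonneg by (intro mult_left_mono) auto
      also have "\<dots> = D * h k + (sqrt (w k) * up k * cmod (f (Suc k)) + g k)"
        by (simp add: h_def g_def algebra_simps)
      also have "sqrt (w k) * up k * cmod (f (Suc k)) \<le> E * sqrt (w (Suc k)) * cmod (f (Suc k))"
        unfolding E_def by (intro mult_right_mono sqrt_w_up) auto
      finally show ?thesis by (simp add: h_def mult_ac)
    qed
    have "L2_set (\<lambda>k. sqrt (w k) * cmod (T f k)) {..<N} \<le> L2_set (\<lambda>k. D * h k + (E * h (Suc k) + g k)) {..<N}"
      using pt w_nonneg by (intro L2_set_mono) auto
    also have "\<dots> \<le> L2_set (\<lambda>k. D * h k) {..<N} + (L2_set (\<lambda>k. E * h (Suc k)) {..<N} + L2_set g {..<N})"
      by (intro order_trans[OF L2_set_triangle_ineq] add_mono order_refl)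
    also have "L2_set (\<lambda>k. D * h k) {..<N} \<le> D * norm2 w f"
      unfolding L2_set_right_distrib[OF DE(1), symmetric] by (intro mult_left_mono hN DE)
    also have "L2_set (\<lambda>k. E * h (Suc k)) {..<N} \<le> E * norm2 w f"
      unfolding L2_set_right_distrib[OF DE(2), symmetric]
      by (intro mult_left_mono DE order_trans[OF L2_set_Suc_shift_le hN])
    also have "L2_set g {..<N} \<le> E * norm2 w f"
    proof -
      have "L2_set g {..<N} \<le> L2_set (\<lambda>k. g (Suc k)) {..<N}"
        by (rule L2_set_pred_shift_le) (auto simp: g_def)
      also have "\<dots> \<le> L2_set (\<lambda>k. E * h k) {..<N}"
      proof (rule L2_set_mono)
        fix k
        have "g (Suc k) = sqrt (w (Suc k)) * (1 - q ^ Suc k) * cmod (f k)"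
          by (simp add: g_def)
        also have "\<dots> \<le> E * sqrt (w k) * cmod (f k)"
          unfolding E_def by (intro mult_right_mono sqrt_w_down) auto
        finally show "g (Suc k) \<le> E * h k" by (simp add: h_def mult_ac)
      qed (rule g0)
      also have "\<dots> \<le> E * norm2 w f"
        unfolding L2_set_right_distrib[OF DE(2), symmetric] by (intro mult_left_mono hN DE)
      finally show ?thesis .
    qed
    finally show ?thesis by (simp add: algebra_simps)
  qed
  show ?thesis
    using that L2w_I[OF w_nonneg main] by blast
qed

lemma bounded_op_T: "bounded_op_on w T"
proof -
  obtain C where "\<And>f. f \<in> L2w w \<Longrightarrow> T f \<in> L2w w \<and> norm2 w (T f) \<le> C * norm2 w f"
    using T_bounded by metis
  then show ?thesis
    unfolding bounded_op_on_def using T_linear by blast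
qed

lemma T_L2w: "f \<in> L2w w \<Longrightarrow> T f \<in> L2w w"
  using T_bounded by metis

text \<open>Discrete Green identity: the partial sums of the difference telescope to the boundary
  term \<open>e N\<close>, which tends to zero because weighted components of square summable
  functions do.\<close>

lemma self_adjoint_T: "self_adjoint_on w T"
  unfolding self_adjoint_on_def
proof (intro ballI)
  fix f g assume f: "f \<in> L2w w" and g: "g \<in> L2w w"
  define d where "d k = complex_of_real (w k) * T f k * cnj (g k) - complex_of_real (w k) * f k * cnj (T g k)" for k
  define e where "e k = complex_of_real (w k * up k) * (f k * cnj (g (Suc k)) - f (Suc k) * cnj (g k))" for k
  have cT: "cnj (T g k) = of_real (1 + a * q) * cnj (g k) - of_real (q ^ k) * (A + B) * cnj (g k)
      - of_real (up k) * cnj (g (Suc k)) - of_real (1 - q ^ k) * cnj (g (k - 1))" for k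
    unfolding T_cnj[symmetric] by (rule T_eq')
  have part: "(\<Sum>k<Suc N. d k) = e N" for N
  proof (induction N)
    case 0
    show ?case
      by (simp add: d_def e_def T_eq'[of f] cT algebra_simps)
  next
    case (Suc N)
    have "d (Suc N) = complex_of_real (w (Suc N) * up (Suc N)) * (f (Suc N) * cnj (g (Suc (Suc N))) - f (Suc (Suc N)) * cnj (g (Suc N)))
       - complex_of_real (w (Suc N) * (1 - q ^ Suc N)) * (f N * cnj (g (Suc N)) - f (Suc N) * cnj (g N))"
      by (simp add: d_def T_eq'[of f] cT algebra_simps)
    then have "d (Suc N) = e (Suc N) - e N"
      unfolding w_Suc e_def .
    with Suc show ?case by simp
  qed
  have "d sums (inner2 w (T f) g - inner2 w f (T g))"
    unfolding d_def by (intro sums_diff inner2_sums w_nonneg f g T_L2w)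
  then have "(\<lambda>N. \<Sum>k<Suc N. d k) \<longlonglongrightarrow> inner2 w (T f) g - inner2 w f (T g)"
    unfolding sums_def by (rule LIMSEQ_Suc)
  then have lim: "e \<longlonglongrightarrow> inner2 w (T f) g - inner2 w f (T g)"
    by (simp only: part)
  define E where "E = sqrt (a * q * (1 + \<bar>b\<bar>))"
  define F where "F k = sqrt (w k) * cmod (f k)" for k
  define G where "G k = sqrt (w k) * cmod (g k)" for k
  have F: "F \<longlonglongrightarrow> 0" and G: "G \<longlonglongrightarrow> 0"
    unfolding F_def[abs_def] G_def[abs_def] by (intro L2w_component_tendsto_0 w_nonneg f g)+
  have bound: "cmod (e k) \<le> E * (F k * G (Suc k) + F (Suc k) * G k)" for k
  proof -
    have "cmod (e k) \<le> w k * up k * (cmod (f k) * cmod (g (Suc k)) + cmod (f (Suc k)) * cmod (g k))"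
      unfolding e_def norm_mult norm_of_real using w_nonneg[of k] up_pos[of k]
      by (intro mult_mono order_trans[OF norm_triangle_ineq4]) (auto simp: norm_mult)
    also have "w k * up k = sqrt (w k) * (sqrt (w k) * up k)"
      using w_nonneg[of k] by simp
    also have "\<dots> * (cmod (f k) * cmod (g (Suc k)) + cmod (f (Suc k)) * cmod (g k))
       \<le> sqrt (w k) * (E * sqrt (w (Suc k))) * (cmod (f k) * cmod (g (Suc k)) + cmod (f (Suc k)) * cmod (g k))"
      unfolding E_def using w_nonneg by (intro mult_right_mono mult_left_mono sqrt_w_up) auto
    also have "\<dots> = E * (F k * G (Suc k) + F (Suc k) * G k)"
      by (simp add: F_def G_def algebra_simps)
    finally show ?thesis .
  qed
  have "(\<lambda>k. E * (F k * G (Suc k) + F (Suc k) * G k)) \<longlonglongrightarrow> E * (0 * 0 + 0 * 0)"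
    by (intro tendsto_intros F G LIMSEQ_Suc[OF F] LIMSEQ_Suc[OF G])
  then have "e \<longlonglongrightarrow> 0"
    by (intro Lim_null_comparison[OF always_eventually[OF allI[OF bound]]]) simp
  with lim have "inner2 w (T f) g - inner2 w f (T g) = 0"
    by (rule LIMSEQ_unique)
  then show "inner2 w (T f) g = inner2 w f (T g)" by simp
qed

section \<open>Cyclicity of the first unit vector\<close>

definition e0 :: "nat \<Rightarrow> complex" where
  "e0 k = (if k = 0 then 1 else 0)"

lemma T_power_e0_above: "n < k \<Longrightarrow> (T ^^ n) e0 k = 0"
  by (induction n arbitrary: k) (auto simp: e0_def T_eq')

text \<open>Each application of \<open>T\<close> extends the support by one index, and the new top
  entry is the old one times \<open>- (1 - q ^ Suc n)\<close>.\<close>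

lemma T_power_e0_diag: "(T ^^ n) e0 n \<noteq> 0"
proof (induction n)
  case (Suc n)
  have "(T ^^ Suc n) e0 (Suc n) = - of_real (1 - q ^ Suc n) * (T ^^ n) e0 n"
    using T_power_e0_above[of n "Suc n"] T_power_e0_above[of n "Suc (Suc n)"]
    by (simp add: T_eq' algebra_simps)
  moreover have "complex_of_real (1 - q ^ Suc n) \<noteq> 0"
    using pow_Suc_less_1[of n] by (simp only: of_real_eq_0_iff)
  ultimately show ?case
    using Suc by simp
qed (simp add: e0_def)

text \<open>Triangular elimination: a multiple of the iterate of order \<open>N\<close> clears the
  top entry, and induction handles the rest.\<close>

lemma finite_support_span:
  fixes f :: "nat \<Rightarrow> complex"
  assumes "\<And>k. N \<le> k \<Longrightarrow> f k = 0"
  shows "\<exists>c. \<forall>k. f k = (\<Sum>n<N. c n * (T ^^ n) e0 k)"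
  using assms
proof (induction N arbitrary: f)
  case (Suc N)
  define t where "t = f N / (T ^^ N) e0 N"
  have "\<exists>c. \<forall>k. f k - t * (T ^^ N) e0 k = (\<Sum>n<N. c n * (T ^^ n) e0 k)"
  proof (rule Suc.IH)
    fix k assume "N \<le> k"
    then consider "k = N" | "N < k" by linarith
    then show "f k - t * (T ^^ N) e0 k = 0"
      using Suc.prems T_power_e0_above T_power_e0_diag by cases (auto simp: t_def)
  qed
  then obtain c where c: "\<And>k. f k - t * (T ^^ N) e0 k = (\<Sum>n<N. c n * (T ^^ n) e0 k)"
    by blast
  have "f k = (\<Sum>n<Suc N. (c(N := t)) n * (T ^^ n) e0 k)" for k
    using c[of k] by (simp add: algebra_simps)
  then show ?case by blast
qed simp

text \<open>The cyclic vector is \<open>e0\<close>: cutting \<open>f\<close> off at a large index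
  leaves a small tail, and the cut-off function lies in the span of the iterates.\<close>

lemma simple_spectrum_T: "simple_spectrum_on w T"
  unfolding simple_spectrum_on_def
proof (intro bexI ballI allI impI)
  show "e0 \<in> L2w w"
    by (rule L2w_finite_support(1)[of 1]) (simp add: e0_def)
  fix f and e :: real assume f: "f \<in> L2w w" and e: "0 < e"
  have s: "summable (\<lambda>k. w k * (cmod (f k))\<^sup>2)"
    using f by (simp add: L2w_def)
  obtain N where N: "\<And>n. N \<le> n \<Longrightarrow> norm (\<Sum>i. w (i + n) * (cmod (f (i + n)))\<^sup>2) < e\<^sup>2"
    using suminf_exist_split[OF _ s, of "e\<^sup>2"] e by auto
  obtain c where c: "\<And>k. (if k < N then f k else 0) = (\<Sum>n<N. c n * (T ^^ n) e0 k)"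
    using finite_support_span[of N "\<lambda>k. if k < N then f k else 0"] by auto
  let ?d = "\<lambda>k. f k - (\<Sum>n<N. c n * (T ^^ n) e0 k)"
  have d: "?d = (\<lambda>k. if k < N then 0 else f k)"
    unfolding c[symmetric] by auto
  have "(\<lambda>k. w k * (cmod (if k < N then 0 else f k))\<^sup>2) sums (\<Sum>i. w (i + N) * (cmod (f (i + N)))\<^sup>2)"
    using summable_sums[OF summable_ignore_initial_segment[OF s, of N]]
      sums_iff_shift[of "\<lambda>k. w k * (cmod (if k < N then 0 else f k))\<^sup>2" N] by simp
  then have "(\<lambda>k. w k * (cmod (?d k))\<^sup>2) sums (\<Sum>i. w (i + N) * (cmod (f (i + N)))\<^sup>2)"
    unfolding fun_cong[OF d] .
  then have "norm2 w ?d = sqrt (\<Sum>i. w (i + N) * (cmod (f (i + N)))\<^sup>2)"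
    unfolding norm2_def by (simp add: sums_iff)
  also have "\<dots> < e"
    using N[of N] e by (intro real_less_lsqrt) auto
  finally show "\<exists>N c. norm2 w (\<lambda>k. f k - (\<Sum>n<N. c n * (T ^^ n) e0 k)) < e"
    by blast
qed

end

subsection \<open>Approximate eigenvectors and eigenvectors\<close>

lemma not_in_spectrumE:
  assumes "z \<notin> spectrum_on w T"
  obtains S where "bounded_op_on w S"
    "\<And>f. f \<in> L2w w \<Longrightarrow> S (\<lambda>k. T f k - z * f k) = f"
  using assms unfolding spectrum_on_def by blast

lemma eigenvalue_in_spectrum:
  assumes f: "f \<in> L2w w" "\<And>k. T f k = z * f k" and nz: "f k \<noteq> 0"
  shows "z \<in> spectrum_on w T"
proof (rule ccontr)
  assume "z \<notin> spectrum_on w T"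
  then obtain S where S: "bounded_op_on w S" "\<And>f. f \<in> L2w w \<Longrightarrow> S (\<lambda>k. T f k - z * f k) = f"
    by (rule not_in_spectrumE) blast
  \<comment> \<open>Linearity with both coefficients zero says that \<open>S\<close> maps the zero
    function to itself.\<close>
  have "S (\<lambda>k. 0 * f k + 0 * f k) = (\<lambda>k. 0 * S f k + 0 * S f k)"
    using S(1) f(1) unfolding bounded_op_on_def by blast
  then have "S (\<lambda>k. T f k - z * f k) = (\<lambda>k. 0)"
    using f(2) by simp
  with S(2)[OF f(1)] nz show False by metis
qed

context q_jacobi
begin

lemma L2w_geometric:
  assumes r: "0 \<le> r" "r < 1" and K: "\<And>n. sqrt (w n) * cmod (f n) \<le> K * r ^ n"
  shows "f \<in> L2w w"
proof (rule L2w_I(1)[OF w_nonneg])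
  fix N
  have K0: "0 \<le> K"
    using K[of 0] by (smt (verit) power_0 mult_cancel_left1 mult_nonneg_nonneg norm_ge_zero real_sqrt_ge_zero w_nonneg)
  have "L2_set (\<lambda>k. sqrt (w k) * cmod (f k)) {..<N} \<le> (\<Sum>k<N. sqrt (w k) * cmod (f k))"
    using w_nonneg by (intro L2_set_le_sum) auto
  also have "\<dots> \<le> (\<Sum>k<N. K * r ^ k)"
    by (intro sum_mono K)
  also have "\<dots> \<le> (\<Sum>k. K * r ^ k)"
    using r K0 by (intro sum_le_suminf summable_mult summable_geometric) auto
  finally show "L2_set (\<lambda>k. sqrt (w k) * cmod (f k)) {..<N} \<le> (\<Sum>k. K * r ^ k)" .
qed

text \<open>Together with \<open>T_eq\<close> this shows that \<open>A\<close> and \<open>B\<close>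
  enter the recurrence only through their sum and product, so their roles can be exchanged.\<close>

lemma up_AB: "complex_of_real (up k) = of_real (a * q) - A * B * of_real (q ^ k)"
  unfolding AB up_def by (simp add: algebra_simps power2_eq_square)

text \<open>The truncated plane waves \<open>s\<^sup>-\<^sup>k\<close> are approximate eigenvectors: the defect
  consists of a part of size \<open>O(q\<^sup>k)\<close>, by which the recurrence differs from one with constant
  coefficients, and of two boundary terms.\<close>

lemma continuous_spectrum:
  assumes s: "cmod s = sqrt (a * q)"
  shows "1 + of_real (a * q) - s - of_real (a * q) / s \<in> spectrum_on w T" (is "?z \<in> _")
proof (rule ccontr)
  assume "?z \<notin> spectrum_on w T"
  then obtain S where S: "bounded_op_on w S" "\<And>f. f \<in> L2w w \<Longrightarrow> S (\<lambda>k. T f k - ?z * f k) = f"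
    by (rule not_in_spectrumE) blast
  then obtain C where C: "\<And>f. f \<in> L2w w \<Longrightarrow> norm2 w (S f) \<le> C * norm2 w f"
    unfolding bounded_op_on_def by blast
  obtain l u where lu: "0 < l" "0 < u" "\<And>k. l * sqrt (a * q) ^ k \<le> sqrt (w k)"
    "\<And>k. sqrt (w k) \<le> u * sqrt (a * q) ^ k"
    using sqrt_w_bounds by metis
  define \<rho> where "\<rho> = sqrt (a * q)"
  have \<rho>: "0 < \<rho>" using a q by (simp add: \<rho>_def)
  have s0: "s \<noteq> 0" using s \<rho> by (auto simp: \<rho>_def)
  \<comment> \<open>The factor of \<open>q ^ k\<close> that remains when \<open>(1 / s) ^ k\<close>
    is inserted into the recurrence.\<close>
  define \<kappa> where "\<kappa> = s - (A + B) + A * B / s"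
  define U where "U = a * q * (1 + \<bar>b\<bar>)"
  have U: "0 \<le> U" using a q by (simp add: U_def)
  define M where "M = cmod \<kappa> * u * (1 / (1 - q)) + u * U / \<rho> + u * \<rho>"
  \<comment> \<open>The wave truncated after index \<open>n\<close> has norm at least
    \<open>l * sqrt (n + 1)\<close>, while its defect has norm at most \<open>M\<close>,
    independently of \<open>n\<close>. A bounded inverse cannot allow this for all
    \<open>n\<close>.\<close>
  have "l * sqrt (real (Suc n)) \<le> \<bar>C\<bar> * M" for n
  proof -
    define f where "f k = (if k \<le> n then (1 / s) ^ k else 0)" for k
    define g where "g = (\<lambda>k. T f k - ?z * f k)"
    have f: "f \<in> L2w w"
      by (rule L2w_finite_support(1)[of "Suc n"]) (simp add: f_def)
    \<comment> \<open>The boundary terms sit at \<open>n\<close>, where the upper neighbour has been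
      cut off, and at \<open>n + 1\<close>, where the last retained entry is the lower
      neighbour.\<close>
    have g_eq: "g k = \<kappa> * of_real (q ^ k) * f k
        + (if k = n then of_real (up k) * (1 / s) ^ Suc k else 0)
        - (if k = Suc n then of_real (1 - q ^ k) * (1 / s) ^ n else 0)" for k
    proof -
      have g: "g k = (s + of_real (a * q) / s - of_real (q ^ k) * (A + B)) * f k
        - of_real (up k) * f (Suc k) - of_real (1 - q ^ k) * f (k - 1)"
        unfolding g_def by (rule T_eq[OF s0])
      show ?thesis
      proof (cases k)
        case 0
        then show ?thesis
          using s0 unfolding g up_AB
          by (auto simp: f_def \<kappa>_def field_simps)
      next
        case (Suc m)
        consider "k < n" | "k = n" | "k = Suc n" | "k > Suc n" by linarith
        then show ?thesis
          using s0 unfolding g up_AB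
          by cases (auto simp: f_def \<kappa>_def field_simps Suc)
      qed
    qed
    have g_le: "sqrt (w k) * cmod (g k) \<le> cmod \<kappa> * u * q ^ k
        + ((if k = n then u * U / \<rho> else 0) + (if k = Suc n then u * \<rho> else 0))" for k
    proof -
      have wk: "sqrt (w k) * (1 / \<rho>) ^ k \<le> u"
        using lu(4)[of k] \<rho> by (simp add: \<rho>_def[symmetric] power_divide field_simps)
      have t1: "sqrt (w k) * cmod (\<kappa> * of_real (q ^ k) * f k) \<le> cmod \<kappa> * u * q ^ k"
      proof -
        have "cmod (f k) \<le> (1 / \<rho>) ^ k"
          using s \<rho> by (simp add: f_def norm_power norm_divide \<rho>_def)
        then have "sqrt (w k) * cmod (f k) \<le> sqrt (w k) * (1 / \<rho>) ^ k"
          using w_nonneg[of k] by (intro mult_left_mono) auto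
        then have "cmod \<kappa> * q ^ k * (sqrt (w k) * cmod (f k)) \<le> cmod \<kappa> * q ^ k * u"
          using wk q by (intro mult_left_mono) auto
        then show ?thesis
          using q by (simp add: norm_mult norm_power mult_ac)
      qed
      have t2: "sqrt (w k) * cmod (of_real (up k) * (1 / s) ^ Suc k) \<le> u * U / \<rho>"
      proof -
        have "sqrt (w k) * cmod (of_real (up k) * (1 / s) ^ Suc k)
            = (sqrt (w k) * (1 / \<rho>) ^ k) * up k / \<rho>"
          using up_pos[of k] s \<rho> by (simp add: norm_mult norm_power norm_divide \<rho>_def[symmetric])
        also have "\<dots> \<le> u * U / \<rho>"
          using wk up_pos[of k] up_le[of k] lu(2) \<rho> unfolding U_def
          by (intro divide_right_mono mult_mono) auto
        finally show ?thesis .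
      qed
      have t3: "sqrt (w k) * cmod (of_real (1 - q ^ k) * (1 / s) ^ n) \<le> u * \<rho>" if "k = Suc n"
      proof -
        have "sqrt (w k) * cmod (of_real (1 - q ^ k) * (1 / s) ^ n)
            = (sqrt (w k) * (1 / \<rho>) ^ k) * \<rho> * (1 - q ^ k)"
          using pow_le_1[of k] s \<rho> unfolding norm_mult norm_of_real
          by (simp add: norm_power norm_divide \<rho>_def[symmetric] that)
        also have "\<dots> \<le> u * \<rho> * 1"
          using wk lu(2) \<rho> pow_le_1[of k] pow_pos[of k]
          by (intro mult_mono mult_right_mono) auto
        finally show ?thesis by simp
      qed
      have "cmod (g k) \<le> cmod (\<kappa> * of_real (q ^ k) * f k)
        + cmod (if k = n then of_real (up k) * (1 / s) ^ Suc k else 0)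
        + cmod (if k = Suc n then of_real (1 - q ^ k) * (1 / s) ^ n else 0)"
        unfolding g_eq by (intro order_trans[OF norm_triangle_ineq4] add_mono norm_triangle_ineq order_refl)
      then have "sqrt (w k) * cmod (g k) \<le> sqrt (w k) * (cmod (\<kappa> * of_real (q ^ k) * f k)
        + cmod (if k = n then of_real (up k) * (1 / s) ^ Suc k else 0)
        + cmod (if k = Suc n then of_real (1 - q ^ k) * (1 / s) ^ n else 0))"
        using w_nonneg[of k] by (intro mult_left_mono) auto
      then show ?thesis
        using t1 t2 t3 by (simp only: distrib_left if_distrib[of cmod] norm_zero split: if_splits) simp_all
    qed
    have gM: "norm2 w g \<le> M"
    proof (rule L2w_I(2)[OF w_nonneg])
      fix N
      have "L2_set (\<lambda>k. sqrt (w k) * cmod (g k)) {..<N} \<le> (\<Sum>k<N. sqrt (w k) * cmod (g k))"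
        using w_nonneg by (intro L2_set_le_sum) auto
      also have "\<dots> \<le> (\<Sum>k<N. cmod \<kappa> * u * q ^ k + ((if k = n then u * U / \<rho> else 0) + (if k = Suc n then u * \<rho> else 0)))"
        by (intro sum_mono g_le)
      also have "\<dots> = cmod \<kappa> * u * (\<Sum>k<N. q ^ k) + ((if n < N then u * U / \<rho> else 0) + (if Suc n < N then u * \<rho> else 0))"
        by (simp add: sum.distrib sum_distrib_left)
      also have "\<dots> \<le> cmod \<kappa> * u * (1 / (1 - q)) + (u * U / \<rho> + u * \<rho>)"
      proof (intro add_mono mult_left_mono)
        have "(\<Sum>k<N. q ^ k) \<le> (\<Sum>k. q ^ k)"
          using q by (intro sum_le_suminf summable_geometric) auto
        then show "(\<Sum>k<N. q ^ k) \<le> 1 / (1 - q)"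
          using q by (simp add: suminf_geometric)
      qed (use lu \<rho> U in auto)
      finally show "L2_set (\<lambda>k. sqrt (w k) * cmod (g k)) {..<N} \<le> M"
        by (simp add: M_def)
    qed
    have g: "g \<in> L2w w"
      by (rule L2w_finite_support(1)[of "Suc (Suc n)"]) (auto simp: g_eq f_def)
    have "l * sqrt (real (Suc n)) = L2_set (\<lambda>k. l) {..<Suc n}"
      using lu by (simp add: L2_set_constant)
    also have "\<dots> \<le> L2_set (\<lambda>k. sqrt (w k) * cmod (f k)) {..<Suc n}"
    proof (rule L2_set_mono)
      fix k assume "k \<in> {..<Suc n}"
      then have "cmod (f k) = (1 / \<rho>) ^ k"
        using s by (simp add: f_def norm_power norm_divide \<rho>_def)
      moreover have "l * \<rho> ^ k * (1 / \<rho>) ^ k \<le> sqrt (w k) * (1 / \<rho>) ^ k"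
        using lu(3)[of k] \<rho> unfolding \<rho>_def[symmetric] by (intro mult_right_mono) auto
      moreover have "l * \<rho> ^ k * (1 / \<rho>) ^ k = l"
        using \<rho> by (simp add: power_divide)
      ultimately show "l \<le> sqrt (w k) * cmod (f k)" by simp
    qed (use lu in simp)
    also have "\<dots> \<le> norm2 w f"
      by (rule L2_set_le_norm2[OF w_nonneg f])
    also have "\<dots> = norm2 w (S g)"
      unfolding g_def S(2)[OF f] ..
    also have "\<dots> \<le> C * norm2 w g"
      by (rule C[OF g])
    also have "\<dots> \<le> \<bar>C\<bar> * norm2 w g"
      using norm2_nonneg[OF w_nonneg g] by (intro mult_right_mono) auto
    also have "\<dots> \<le> \<bar>C\<bar> * M"
      using gM by (intro mult_left_mono) auto
    finally show ?thesis .
  qed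
  then have "sqrt (real (Suc n)) \<le> \<bar>C\<bar> * M / l" for n
    using lu by (simp add: field_simps)
  then have "real (Suc n) \<le> (\<bar>C\<bar> * M / l)\<^sup>2" for n
    by (rule sqrt_le_D)
  then show False
    using reals_Archimedean2[of "(\<bar>C\<bar> * M / l)\<^sup>2"] by (smt (verit) of_nat_Suc)
qed

text \<open>With \<open>x = q\<^sup>-\<^sup>n\<close>, conjugating by \<open>A'\<^sup>-\<^sup>n\<close> turns the recurrence operator into one that is
  triangular on polynomials in \<open>x\<close>, with diagonal entries \<open>\<mu> j\<close> and superdiagonal entries \<open>\<nu> j\<close>.\<close>

lemma discrete_spectrum:
  assumes sum: "A' + B' = A + B" and prod: "A' * B' = A * B"
    and s: "s = A' * of_real (q ^ k)" and large: "sqrt (a * q) < cmod s"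
  shows "1 + of_real (a * q) - s - of_real (a * q) / s \<in> spectrum_on w T" (is "?z \<in> _")
proof -
  define t where "t = complex_of_real (a * q)"
  define p where "p = complex_of_real q"
  have p0: "p \<noteq> 0" using q by (simp add: p_def)
  have aq0: "0 \<le> sqrt (a * q)" using a q by simp
  have s0: "s \<noteq> 0" using large aq0 by auto
  then have A0: "A' \<noteq> 0" using s by auto
  define \<mu> where "\<mu> j = A' * p ^ j + t / (A' * p ^ j) - s - t / s" for j
  define \<nu> where "\<nu> j = A' * (1 - p ^ j) + B' * (1 - 1 / p ^ j)" for j
  \<comment> \<open>Kernel vector of the triangular operator, normalized by \<open>c k = 1\<close>
    and solved downwards; \<open>c_rec\<close> is its defining equation.\<close>
  define c where "c j = (\<Prod>i=j..<k. - \<nu> (Suc i) / \<mu> i)" for j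
  have \<mu>k: "\<mu> k = 0" by (simp add: \<mu>_def s p_def)
  have \<nu>0: "\<nu> 0 = 0" by (simp add: \<nu>_def)
  \<comment> \<open>With \<open>y = A' * p ^ j\<close>, \<open>\<mu> j\<close> factors as
    \<open>(y - s) * (1 - t / (y * s))\<close>. The first factor is nonzero since
    \<open>cmod y > cmod s\<close>, the second since both moduli exceed
    \<open>sqrt (a * q)\<close>.\<close>
  have \<mu>: "\<mu> j \<noteq> 0" if "j < k" for j
  proof
    assume "\<mu> j = 0"
    define y where "y = A' * p ^ j"
    have y0: "y \<noteq> 0" using A0 p0 by (simp add: y_def)
    have ys: "cmod s < cmod y"
    proof -
      have "q ^ k < q ^ j" using that q by (intro power_strict_decreasing) auto
      then have "cmod A' * q ^ k < cmod A' * q ^ j" using A0 by simp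
      then show ?thesis using q by (simp add: s y_def p_def norm_mult norm_power)
    qed
    have "(y - s) * (1 - t / (y * s)) = \<mu> j"
      using y0 s0 by (simp add: \<mu>_def y_def[symmetric] field_simps)
    moreover have "y \<noteq> s" using ys by auto
    ultimately have "1 - t / (y * s) = 0"
      using \<open>\<mu> j = 0\<close> by simp
    then have "t = y * s"
      using y0 s0 by (simp add: field_simps)
    then have "a * q = cmod y * cmod s"
      using a q by (metis t_def norm_mult norm_of_real abs_of_nonneg less_imp_le mult_pos_pos)
    also have "\<dots> > sqrt (a * q) * sqrt (a * q)"
      using large ys aq0 by (intro mult_strict_mono') auto
    finally show False using a q by simp
  qed
  have c_rec: "c j * \<mu> j + c (Suc j) * \<nu> (Suc j) = 0" if "j < k" for j
    using \<mu>[OF that] that by (simp add: c_def prod.atLeast_Suc_lessThan)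
  define P where "P x = (\<Sum>j\<le>k. c j * x ^ j)" for x
  define f where "f n = (1 / A') ^ n * P ((1 / p) ^ n)" for n
  have P_eq: "(s + t / s - (A' + B') / x) * P x - (t / A' - B' / x) * P (x / p)
      - (1 - 1 / x) * A' * P (x * p) = 0" if x: "x \<noteq> 0" for x
  proof -
    have "(s + t / s - (A' + B') / x) * P x - (t / A' - B' / x) * P (x / p) - (1 - 1 / x) * A' * P (x * p)
       = (\<Sum>j\<le>k. c j * ((s + t / s - (A' + B') / x) * x ^ j - (t / A' - B' / x) * (x / p) ^ j
           - (1 - 1 / x) * A' * (x * p) ^ j))"
      by (simp add: P_def sum_distrib_left sum_subtractf right_diff_distrib mult_ac)
    also have "\<dots> = (\<Sum>j\<le>k. - (c j * \<mu> j * x ^ j) - c j * \<nu> j * x ^ j / x)"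
    proof (rule sum.cong)
      fix j
      have *: "(s + t / s - (A' + B') / x) * x ^ j - (t / A' - B' / x) * (x / p) ^ j
           - (1 - 1 / x) * A' * (x * p) ^ j = - (\<mu> j * x ^ j) - \<nu> j * x ^ j / x"
      proof -
        define X R where "X = x ^ j" and "R = p ^ j"
        have "R \<noteq> 0" using p0 by (simp add: R_def)
        then show ?thesis
          using x s0 A0 unfolding \<mu>_def \<nu>_def power_divide power_mult_distrib X_def[symmetric] R_def[symmetric]
          by (simp add: divide_simps) (simp add: algebra_simps)
      qed
      show "c j * ((s + t / s - (A' + B') / x) * x ^ j - (t / A' - B' / x) * (x / p) ^ j
           - (1 - 1 / x) * A' * (x * p) ^ j) = - (c j * \<mu> j * x ^ j) - c j * \<nu> j * x ^ j / x"
        by (simp only: *) (simp add: algebra_simps)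
    qed simp
    also have "\<dots> = - (\<Sum>j\<le>k. c j * \<mu> j * x ^ j) - (\<Sum>j\<le>k. c j * \<nu> j * x ^ j / x)"
      by (simp add: sum_subtractf sum_negf)
    \<comment> \<open>The top summand drops out by \<open>\<mu> k = 0\<close>, and in the next sum
      the bottom one by \<open>\<nu> 0 = 0\<close>. After the index shift the two sums cancel by
      \<open>c_rec\<close>.\<close>
    also have "(\<Sum>j\<le>k. c j * \<mu> j * x ^ j) = (\<Sum>j<k. c j * \<mu> j * x ^ j)"
      unfolding lessThan_Suc_atMost[symmetric] by (simp add: \<mu>k)
    also have "(\<Sum>j\<le>k. c j * \<nu> j * x ^ j / x) = (\<Sum>j<k. c (Suc j) * \<nu> (Suc j) * x ^ j)"
      unfolding lessThan_Suc_atMost[symmetric] sum.lessThan_Suc_shift using x by (simp add: \<nu>0 mult.assoc)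
    also have "- (\<Sum>j<k. c j * \<mu> j * x ^ j) - (\<Sum>j<k. c (Suc j) * \<nu> (Suc j) * x ^ j)
       = - (\<Sum>j<k. (c j * \<mu> j + c (Suc j) * \<nu> (Suc j)) * x ^ j)"
      by (simp add: sum.distrib distrib_right)
    also have "\<dots> = 0"
      by (simp add: c_rec)
    finally show ?thesis .
  qed
  have eigen: "T f n = ?z * f n" for n
  proof -
    define x where "x = (1 / p) ^ n"
    have x0: "x \<noteq> 0" using p0 by (simp add: x_def)
    have qn: "complex_of_real (q ^ n) = 1 / x"
      using p0 by (simp add: x_def p_def power_divide)
    have f1: "f (Suc n) = (1 / A') ^ n * (P (x / p) / A')"
      by (simp add: f_def x_def mult_ac)
    have f2: "of_real (1 - q ^ n) * f (n - 1) = (1 / A') ^ n * ((1 - 1 / x) * A' * P (x * p))"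
    proof (cases n)
      case 0
      then show ?thesis by (simp add: x_def)
    next
      case (Suc m)
      then show ?thesis
        using A0 p0 qn by (simp add: f_def x_def power_divide)
    qed
    have "T f n - ?z * f n = (1 / A') ^ n * ((s + t / s - (A' + B') / x) * P x
        - (t - A * B / x) * (P (x / p) / A') - (1 - 1 / x) * A' * P (x * p))"
      by (subst T_eq[OF s0], simp only: up_AB qn f1 f2 sum t_def[symmetric])
        (simp add: f_def x_def[symmetric] diff_divide_distrib algebra_simps)
    also have "(t - A * B / x) * (P (x / p) / A') = (t / A' - B' / x) * P (x / p)"
      using A0 x0 by (simp add: prod[symmetric] field_simps)
    finally show ?thesis
      using P_eq[OF x0] by simp
  qed
  \<comment> \<open>\<open>P\<close> has leading coefficient \<open>1\<close>, so it cannot vanish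
    at the infinitely many distinct points \<open>(1 / p) ^ n\<close>.\<close>
  have "\<exists>n. f n \<noteq> 0"
  proof (rule ccontr)
    assume "\<nexists>n. f n \<noteq> 0"
    then have "P ((1 / p) ^ n) = 0" for n
      using A0 by (auto simp: f_def)
    then have "range (\<lambda>n. (1 / p) ^ n) \<subseteq> {x. (\<Sum>j\<le>k. c j * x ^ j) = 0}"
      by (auto simp: P_def)
    moreover have "finite {x. (\<Sum>j\<le>k. c j * x ^ j) = 0}"
      unfolding polyfun_finite_roots by (rule exI[of _ k]) (simp add: c_def)
    moreover have "inj (\<lambda>n. (1 / p) ^ n)"
    proof (rule injI)
      fix m n assume "(1 / p) ^ m = (1 / p) ^ n"
      then have "cmod ((1 / p) ^ m) = cmod ((1 / p) ^ n)" by simp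
      then have "(1 / q) ^ m = (1 / q) ^ n"
        using q by (simp add: norm_power norm_divide p_def)
      then show "m = n"
        using q by (subst (asm) power_inject_exp) auto
    qed
    ultimately show False
      using finite_subset range_inj_infinite by blast
  qed
  then obtain n0 where n0: "f n0 \<noteq> 0" by blast
  obtain l u where lu: "0 < u" "\<And>k. sqrt (w k) \<le> u * sqrt (a * q) ^ k"
    using sqrt_w_bounds by metis
  define K where "K = (\<Sum>j\<le>k. cmod (c j))"
  \<comment> \<open>\<open>P\<close> grows at most like \<open>q\<close> to the power
    \<open>- k * n\<close>; combined with \<open>(1 / A') ^ n\<close> this gives the rate
    \<open>1 / cmod s\<close>.\<close>
  have "sqrt (w n) * cmod (f n) \<le> (u * K) * (sqrt (a * q) / cmod s) ^ n" for n
  proof -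
    have "cmod (P ((1 / p) ^ n)) \<le> (\<Sum>j\<le>k. cmod (c j * ((1 / p) ^ n) ^ j))"
      unfolding P_def by (rule norm_sum)
    also have "\<dots> \<le> (\<Sum>j\<le>k. cmod (c j) * ((1 / q) ^ k) ^ n)"
    proof (rule sum_mono)
      fix j assume "j \<in> {..k}"
      then have "(1 / q) ^ (j * n) \<le> (1 / q) ^ (k * n)"
        using q by (intro power_increasing) auto
      then show "cmod (c j * ((1 / p) ^ n) ^ j) \<le> cmod (c j) * ((1 / q) ^ k) ^ n"
        using q unfolding norm_mult norm_power power_mult[symmetric]
        by (intro mult_left_mono) (auto simp: p_def norm_divide mult.commute)
    qed
    also have "\<dots> = K * ((1 / q) ^ k) ^ n"
      by (simp add: K_def sum_distrib_right)
    finally have "sqrt (w n) * (cmod (1 / A') ^ n * cmod (P ((1 / p) ^ n)))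
        \<le> (u * sqrt (a * q) ^ n) * (cmod (1 / A') ^ n * (K * ((1 / q) ^ k) ^ n))"
      using lu w_nonneg aq0 by (intro mult_mono mult_left_mono) auto
    also have "\<dots> = (u * K) * (sqrt (a * q) / cmod s) ^ n"
      using q by (simp add: s norm_mult norm_power norm_divide power_divide power_mult_distrib)
    finally show ?thesis
      by (simp add: f_def norm_mult norm_power)
  qed
  then have "f \<in> L2w w"
    by (rule L2w_geometric[rotated 2]) (use large aq0 s0 in \<open>auto simp: divide_simps\<close>)
  then show ?thesis
    using eigenvalue_in_spectrum eigen n0 by blast
qed

end

subsection \<open>The decaying and the polynomial solution of the recurrence\<close>

locale q_jacobi_resolvent = q_jacobi +
  fixes s :: complex
  assumes large: "sqrt (a * q) < cmod s"
begin

definition p :: complex where "p = of_real q"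
definition t :: complex where "t = of_real (a * q)"
definition z :: complex where "z = 1 + t - s - t / s"
text \<open>The geometric rate that, in the weighted norm, bounds the decay of \<psi> and, inverted,
  the growth of \<open>pol\<close>.\<close>

definition r :: real where "r = sqrt (a * q) / cmod s"

lemma sqrt_aq_pos: "0 < sqrt (a * q)"
  using a q by simp

lemma s_nz: "s \<noteq> 0" and p_nz: "p \<noteq> 0" and t_nz: "t \<noteq> 0"
proof -
  show "s \<noteq> 0" using large sqrt_aq_pos by (metis norm_zero less_asym)
  show "p \<noteq> 0" "t \<noteq> 0" using q a by (auto simp: p_def t_def)
qed

lemma norm_p: "cmod p = q"
  using q by (simp add: p_def)

lemma r: "0 < r" "r < 1"
  using large sqrt_aq_pos by (auto simp: r_def divide_simps)

lemma norm_ratio: "cmod (t / s\<^sup>2) = r\<^sup>2"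
proof -
  have "cmod t = (sqrt (a * q))\<^sup>2"
    using a q by (simp add: t_def norm_mult)
  then show ?thesis
    by (simp only: r_def norm_divide norm_power power_divide)
qed

lemma r2_less_1: "r\<^sup>2 < 1"
  using r by (simp add: power_less_one_iff)

lemma T_minus_z:
  "T f n - z * f n = (s + t / s - p ^ n * (A + B)) * f n
      - of_real (up n) * f (Suc n) - (1 - p ^ n) * f (n - 1)"
  using T_eq[OF s_nz, of f n] by (simp add: z_def p_def t_def)

lemma up_eq: "complex_of_real (up n) = t - A * B * p ^ n"
  using up_AB[of n] by (simp add: p_def t_def)

section \<open>The decaying solution as a basic hypergeometric series\<close>

definition e :: "nat \<Rightarrow> complex" where
  "e j = qpoch (A / s) p j * qpoch (B / s) p j / (qpoch p p j * qpoch (t / s\<^sup>2 * p) p j)"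

definition D :: complex where "D = lim e"

lemma power_p_not_1: "x * p * p ^ j \<noteq> 1" if "cmod x \<le> 1"
proof
  assume "x * p * p ^ j = 1"
  then have "cmod x * q ^ Suc j = 1"
    by (metis mult.assoc norm_mult norm_one norm_p norm_power power_Suc)
  moreover have "cmod x * q ^ Suc j \<le> 1 * q ^ Suc j"
    using that q by (intro mult_right_mono) auto
  ultimately show False
    using pow_Suc_less_1[of j] by linarith
qed

lemma e_denominator_nz: "1 - p * p ^ j \<noteq> 0" "1 - t / s\<^sup>2 * p * p ^ j \<noteq> 0"
  using power_p_not_1[of 1 j] power_p_not_1[of "t / s\<^sup>2" j] norm_ratio r2_less_1 by auto

lemma e_0: "e 0 = 1"
  by (simp add: e_def)

lemma e_Suc:
  "e (Suc j) * ((1 - p * p ^ j) * (1 - t / s\<^sup>2 * p * p ^ j)) = e j * ((1 - A / s * p ^ j) * (1 - B / s * p ^ j))"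
proof -
  have frac: "x * y / (u * v) * (u' * v') = (x * y) / ((u / u') * (v / v'))" if "u' \<noteq> 0" "v' \<noteq> 0"
    for x y u v u' v' :: complex
    using that by (simp add: field_simps)
  show ?thesis
    unfolding e_def qpoch_Suc frac[OF e_denominator_nz]
    using e_denominator_nz[of j] by simp
qed

text \<open>\<open>D\<close> is the quotient of infinite products
  \<open>(A/s, B/s; q) / (q, t q/s^2; q)\<close>. The denominator is nonzero because
  \<open>cmod (t / s^2) < 1\<close>, so a zero comes from a factor of the numerator.\<close>

lemma e_LIMSEQ: "e \<longlonglongrightarrow> D" and D_eq_0: "D = 0 \<Longrightarrow> \<exists>j. s = A * p ^ j \<or> s = B * p ^ j"
proof -
  have p1: "norm p < 1" using q norm_p by simp
  obtain L1 where L1: "qpoch (A / s) p \<longlonglongrightarrow> L1" "L1 = 0 \<longleftrightarrow> (\<exists>j. A / s * p ^ j = 1)"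
    using qpoch_LIMSEQ[OF p1] by metis
  obtain L2 where L2: "qpoch (B / s) p \<longlonglongrightarrow> L2" "L2 = 0 \<longleftrightarrow> (\<exists>j. B / s * p ^ j = 1)"
    using qpoch_LIMSEQ[OF p1] by metis
  obtain L3 where L3: "qpoch p p \<longlonglongrightarrow> L3" "L3 = 0 \<longleftrightarrow> (\<exists>j. p * p ^ j = 1)"
    using qpoch_LIMSEQ[OF p1] by metis
  obtain L4 where L4: "qpoch (t / s\<^sup>2 * p) p \<longlonglongrightarrow> L4" "L4 = 0 \<longleftrightarrow> (\<exists>j. t / s\<^sup>2 * p * p ^ j = 1)"
    using qpoch_LIMSEQ[OF p1] by metis
  have nz: "L3 \<noteq> 0" "L4 \<noteq> 0"
    using L3(2) L4(2) e_denominator_nz by auto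
  have "(\<lambda>j. qpoch (A / s) p j * qpoch (B / s) p j / (qpoch p p j * qpoch (t / s\<^sup>2 * p) p j))
      \<longlonglongrightarrow> L1 * L2 / (L3 * L4)"
    using nz by (intro tendsto_intros L1 L2 L3 L4) auto
  then have lim: "e \<longlonglongrightarrow> L1 * L2 / (L3 * L4)"
    by (simp add: e_def[abs_def])
  then have D: "D = L1 * L2 / (L3 * L4)"
    unfolding D_def by (rule limI)
  with lim show "e \<longlonglongrightarrow> D" by simp
  assume "D = 0"
  then have "L1 = 0 \<or> L2 = 0" using D nz by auto
  then show "\<exists>j. s = A * p ^ j \<or> s = B * p ^ j"
    using L1(2) L2(2) s_nz by (auto simp: divide_simps)
qed

text \<open>The series \<open>2phi1(A/s, B/s; t q/s^2; q, x)\<close>.\<close>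

definition \<phi> :: "complex \<Rightarrow> complex" where
  "\<phi> x = (\<Sum>j. e j * x ^ j)"

lemma e_bounded: obtains K where "0 < K" "\<And>j. cmod (e j) \<le> K"
  using convergent_imp_Bseq[OF convergentI[OF e_LIMSEQ]] by (auto simp: Bseq_def)

lemma e_power_summable:
  assumes "cmod x < 1"
  shows "summable (\<lambda>j. cmod (e j * x ^ j))"
proof -
  obtain K where K: "\<And>j. cmod (e j) \<le> K" using e_bounded by metis
  have "summable (\<lambda>j. K * cmod x ^ j)"
    using assms by (intro summable_mult summable_geometric) auto
  then show ?thesis
    by (rule summable_comparison_test')
      (use K in \<open>auto simp: norm_mult norm_power intro!: mult_right_mono\<close>)
qed

lemma \<phi>_LIMSEQ:
  assumes "cmod x < 1"
  shows "(\<lambda>J. \<Sum>j\<le>J. e j * x ^ j) \<longlonglongrightarrow> \<phi> x"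
  using summable_LIMSEQ'[OF summable_norm_cancel[OF e_power_summable[OF assms]]]
  by (simp add: \<phi>_def)

text \<open>For partial sums everything telescopes to a single remainder. One identity thus yields,
  as \<open>J\<close> grows, both the homogeneous equation for \<open>cmod y < 1\<close> and the
  boundary value at \<open>y = 1\<close>.\<close>

lemma partial_recurrence:
  defines "\<Phi> \<equiv> \<lambda>J x. \<Sum>j\<le>J. e j * x ^ j"
  shows "(t - A * B * y) / s * \<Phi> J (p * (p * y)) + s * (1 - y) * \<Phi> J y - (s + t / s - y * (A + B)) * \<Phi> J (p * y)
    = - s * y ^ Suc J * (e J * ((1 - A / s * p ^ J) * (1 - B / s * p ^ J)))"
proof (induction J)
  case 0
  show ?case
    using s_nz by (simp add: \<Phi>_def e_0 field_simps)
next
  case (Suc J)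
  define X R where "X = y ^ Suc J" and "R = p * p ^ J"
  have "(t - A * B * y) / s * \<Phi> (Suc J) (p * (p * y)) + s * (1 - y) * \<Phi> (Suc J) y
       - (s + t / s - y * (A + B)) * \<Phi> (Suc J) (p * y)
     = ((t - A * B * y) / s * \<Phi> J (p * (p * y)) + s * (1 - y) * \<Phi> J y - (s + t / s - y * (A + B)) * \<Phi> J (p * y))
       + e (Suc J) * X * ((t - A * B * y) / s * (R * R) + s * (1 - y) - (s + t / s - y * (A + B)) * R)"
    unfolding \<Phi>_def sum.atMost_Suc X_def R_def by (simp add: power_mult_distrib algebra_simps)
  \<comment> \<open>In this splitting the first product, by \<open>e_Suc\<close>, cancels the
    remainder of the previous stage, and the second is the new remainder.\<close>
  also have "(t - A * B * y) / s * (R * R) + s * (1 - y) - (s + t / s - y * (A + B)) * R =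
     s * ((1 - R) * (1 - t / s\<^sup>2 * R)) - s * y * ((1 - A / s * R) * (1 - B / s * R))"
    using s_nz by (simp add: field_simps power2_eq_square)
  also have "e (Suc J) * X * (s * ((1 - R) * (1 - t / s\<^sup>2 * R)) - s * y * ((1 - A / s * R) * (1 - B / s * R)))
     = s * X * (e (Suc J) * ((1 - R) * (1 - t / s\<^sup>2 * R)))
       - s * (X * y) * (e (Suc J) * ((1 - A / s * R) * (1 - B / s * R)))"
    by (simp add: algebra_simps)
  also have "e (Suc J) * ((1 - R) * (1 - t / s\<^sup>2 * R)) = e J * ((1 - A / s * p ^ J) * (1 - B / s * p ^ J))"
    using e_Suc[of J] by (simp add: R_def mult.assoc)
  finally show ?case
    unfolding Suc.IH by (simp add: X_def R_def mult_ac)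
qed

lemma power_p_tendsto_0: "(\<lambda>J. p ^ J) \<longlonglongrightarrow> 0"
  using q norm_p by (intro LIMSEQ_power_zero) auto

lemma partial_recurrence_rhs_LIMSEQ:
  "(\<lambda>J. e J * ((1 - A / s * p ^ J) * (1 - B / s * p ^ J))) \<longlonglongrightarrow> D"
proof -
  have "(\<lambda>J. e J * ((1 - A / s * p ^ J) * (1 - B / s * p ^ J))) \<longlonglongrightarrow> D * ((1 - A / s * 0) * (1 - B / s * 0))"
    by (intro tendsto_intros e_LIMSEQ power_p_tendsto_0)
  then show ?thesis by simp
qed

lemma norm_p_mult_less_1:
  assumes "cmod y \<le> 1"
  shows "cmod (p * y) < 1"
proof -
  have "q * cmod y \<le> q * 1"
    using assms q by (intro mult_left_mono) auto
  then show ?thesis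
    unfolding norm_mult norm_p using q by linarith
qed

lemma \<phi>_recurrence:
  assumes "cmod y < 1"
  shows "(t - A * B * y) / s * \<phi> (p * (p * y)) + s * (1 - y) * \<phi> y - (s + t / s - y * (A + B)) * \<phi> (p * y) = 0"
proof (rule LIMSEQ_unique)
  have 1: "cmod (p * y) < 1" "cmod (p * (p * y)) < 1"
    using assms norm_p_mult_less_1 by (simp_all add: less_imp_le)
  show "(\<lambda>J. (t - A * B * y) / s * (\<Sum>j\<le>J. e j * (p * (p * y)) ^ j) + s * (1 - y) * (\<Sum>j\<le>J. e j * y ^ j)
     - (s + t / s - y * (A + B)) * (\<Sum>j\<le>J. e j * (p * y) ^ j)) \<longlonglongrightarrow>
     (t - A * B * y) / s * \<phi> (p * (p * y)) + s * (1 - y) * \<phi> y - (s + t / s - y * (A + B)) * \<phi> (p * y)"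
    by (intro tendsto_diff tendsto_add tendsto_mult_left \<phi>_LIMSEQ assms 1)
  have "(\<lambda>J. - s * y ^ Suc J * (e J * ((1 - A / s * p ^ J) * (1 - B / s * p ^ J)))) \<longlonglongrightarrow> - s * 0 * D"
    using assms by (intro tendsto_mult tendsto_const LIMSEQ_Suc LIMSEQ_power_zero partial_recurrence_rhs_LIMSEQ) auto
  then show "(\<lambda>J. (t - A * B * y) / s * (\<Sum>j\<le>J. e j * (p * (p * y)) ^ j) + s * (1 - y) * (\<Sum>j\<le>J. e j * y ^ j)
     - (s + t / s - y * (A + B)) * (\<Sum>j\<le>J. e j * (p * y) ^ j)) \<longlonglongrightarrow> 0"
    by (simp only: partial_recurrence mult_zero_left mult_zero_right)
qed

text \<open>At \<open>y = 1\<close> the series \<open>\<phi> y\<close> diverges; the boundary value \<open>s * D\<close> is the limit of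
  \<open>s * (1 - y) * \<phi> y\<close> as \<open>y\<close> tends to \<open>1\<close> from below.\<close>

lemma \<phi>_recurrence_boundary:
  "(s + t / s - (A + B)) * \<phi> p - (t - A * B) / s * \<phi> (p * p) = s * D"
proof -
  have 1: "cmod p < 1" "cmod (p * p) < 1"
    using norm_p_mult_less_1[of 1] norm_p_mult_less_1[of p] by auto
  have "(t - A * B) / s * \<phi> (p * p) - (s + t / s - (A + B)) * \<phi> p = - s * D"
  proof (rule LIMSEQ_unique)
    show "(\<lambda>J. (t - A * B) / s * (\<Sum>j\<le>J. e j * (p * p) ^ j) - (s + t / s - (A + B)) * (\<Sum>j\<le>J. e j * p ^ j))
      \<longlonglongrightarrow> (t - A * B) / s * \<phi> (p * p) - (s + t / s - (A + B)) * \<phi> p"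
      by (intro tendsto_diff tendsto_mult_left \<phi>_LIMSEQ 1)
    have "(\<lambda>J. - s * (e J * ((1 - A / s * p ^ J) * (1 - B / s * p ^ J)))) \<longlonglongrightarrow> - s * D"
      by (intro tendsto_mult_left partial_recurrence_rhs_LIMSEQ)
    \<comment> \<open>At \<open>y = 1\<close> the factor \<open>1 - y\<close> removes the partial
      sum at \<open>1\<close> before the limit is taken.\<close>
    then show "(\<lambda>J. (t - A * B) / s * (\<Sum>j\<le>J. e j * (p * p) ^ j) - (s + t / s - (A + B)) * (\<Sum>j\<le>J. e j * p ^ j))
      \<longlonglongrightarrow> - s * D"
      using partial_recurrence[where y = 1] by simp
  qed
  then show ?thesis by (simp add: algebra_simps)
qed

text \<open>With the exponent \<open>Suc n\<close> all arguments lie inside the unit disc; only the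
  fictitious index \<open>-1\<close> would need \<phi> at \<open>1\<close>.\<close>

definition \<psi> :: "nat \<Rightarrow> complex" where
  "\<psi> n = (1 / s) ^ n * \<phi> (p ^ Suc n)"

lemma \<psi>_solution: "T \<psi> n - z * \<psi> n = (if n = 0 then s * D else 0)"
proof (cases n)
  case 0
  then show ?thesis
    using \<phi>_recurrence_boundary unfolding T_minus_z up_eq by (simp add: \<psi>_def mult_ac)
next
  case (Suc m)
  define y where "y = p ^ n"
  have y: "cmod y < 1"
    using pow_Suc_less_1[of m] q by (simp add: y_def Suc norm_mult norm_power norm_p)
  have 1: "\<psi> n = (1 / s) ^ n * \<phi> (p * y)" "\<psi> (Suc n) = (1 / s) ^ n * (\<phi> (p * (p * y)) / s)"
    by (simp_all add: \<psi>_def y_def mult_ac)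
  have 2: "\<psi> (n - 1) = (1 / s) ^ n * (s * \<phi> y)"
    using s_nz by (simp add: \<psi>_def y_def Suc)
  have "T \<psi> n - z * \<psi> n = - ((1 / s) ^ n *
     ((t - A * B * y) / s * \<phi> (p * (p * y)) + s * (1 - y) * \<phi> y - (s + t / s - y * (A + B)) * \<phi> (p * y)))"
    by (subst T_minus_z) (simp only: up_eq 1 2 y_def[symmetric], simp add: algebra_simps)
  then show ?thesis
    unfolding \<phi>_recurrence[OF y] using Suc by simp
qed

lemma \<psi>_bound: obtains K where "0 < K" "\<And>n. sqrt (w n) * cmod (\<psi> n) \<le> K * r ^ n"
proof -
  obtain K where K: "0 < K" "\<And>j. cmod (e j) \<le> K" using e_bounded by metis
  obtain u where u: "0 < u" "\<And>k. sqrt (w k) \<le> u * sqrt (a * q) ^ k"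
    using sqrt_w_bounds by metis
  have \<phi>: "cmod (\<phi> (p ^ Suc n)) \<le> K / (1 - q)" for n
  proof -
    have x: "cmod (p ^ Suc n) \<le> q" "cmod (p ^ Suc n) < 1"
      using pow_le_1[of n] pow_Suc_less_1[of n] q by (simp_all add: norm_mult norm_power norm_p)
    have "cmod (\<phi> (p ^ Suc n)) \<le> (\<Sum>j. cmod (e j * (p ^ Suc n) ^ j))"
      unfolding \<phi>_def by (intro summable_norm e_power_summable x)
    also have "\<dots> \<le> (\<Sum>j. K * q ^ j)"
    proof (rule suminf_le)
      show "summable (\<lambda>j. K * q ^ j)"
        using q by (intro summable_mult summable_geometric) auto
      show "cmod (e j * (p ^ Suc n) ^ j) \<le> K * q ^ j" for j
        unfolding norm_mult norm_power[of _ j] using K x(1) by (intro mult_mono power_mono) auto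
    qed (intro e_power_summable x)
    also have "\<dots> = K / (1 - q)"
      using q by (subst suminf_mult) (auto intro: summable_geometric simp: suminf_geometric)
    finally show ?thesis .
  qed
  show ?thesis
  proof
    show "0 < u * (K / (1 - q))" using u K q by simp
    fix n
    have "sqrt (w n) * cmod (\<psi> n) \<le> (u * sqrt (a * q) ^ n) * (cmod (1 / s) ^ n * (K / (1 - q)))"
      unfolding \<psi>_def norm_mult norm_power[of _ n]
      using \<phi> u w_nonneg sqrt_aq_pos by (intro mult_mono mult_left_mono) auto
    also have "\<dots> = u * (K / (1 - q)) * r ^ n"
      by (simp add: r_def norm_divide power_divide mult_ac)
    finally show "sqrt (w n) * cmod (\<psi> n) \<le> u * (K / (1 - q)) * r ^ n" .
  qed
qed

section \<open>The polynomial solution and its growth\<close>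

fun pol :: "nat \<Rightarrow> complex" where
  "pol 0 = 1"
| "pol (Suc n) = ((s + t / s - p ^ n * (A + B)) * pol n - (1 - p ^ n) * pol (n - 1)) / of_real (up n)"

declare pol.simps(2) [simp del]

lemma pol_Suc: "of_real (up n) * pol (Suc n) = (s + t / s - p ^ n * (A + B)) * pol n - (1 - p ^ n) * pol (n - 1)"
  using up_pos[of n] by (simp add: pol.simps)

lemma pol_solution: "T pol n - z * pol n = 0"
  unfolding T_minus_z pol_Suc by simp

text \<open>After the rescaling \<open>g n = pol n * (t / s)\<^sup>n\<close> the increments of \<open>g\<close> contract by the factor
  \<open>\<rho> = |t / s\<^sup>2| < 1\<close> up to an error of size \<open>O(q\<^sup>n)\<close>.\<close>

lemma rescaled_pol_bounded: obtains M where "\<And>n. cmod (pol n * (t / s) ^ n) \<le> M"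
proof -
  define g where "g n = pol n * (t / s) ^ n" for n
  \<comment> \<open>Truncated subtraction gives \<open>\<Delta> 0 = 0\<close>; in the recurrence at
    \<open>n = 0\<close> the previous value has coefficient zero anyway.\<close>
  define \<Delta> where "\<Delta> n = g n - g (n - 1)" for n
  define \<rho> where "\<rho> = r\<^sup>2"
  \<comment> \<open>This weight satisfies \<open>(1 + \<kappa>) * \<rho> \<le> \<kappa>\<close>, so
    \<open>cmod (g n) + \<kappa> * cmod (\<Delta> n)\<close> grows only through the errors of order
    \<open>q ^ n\<close>.\<close>
  define \<kappa> where "\<kappa> = 1 / (1 - \<rho>)"
  define \<delta> where "\<delta> n = 1 - b * q ^ Suc n" for n
  define m where "m = min 1 (1 - q * b)"
  have \<rho>: "0 \<le> \<rho>" "\<rho> < 1" using r2_less_1 by (auto simp: \<rho>_def)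
  have \<kappa>: "1 \<le> \<kappa>" "(1 + \<kappa>) * \<rho> \<le> \<kappa>"
  proof -
    show "1 \<le> \<kappa>" using \<rho> by (simp add: \<kappa>_def)
    have "0 \<le> (1 - \<rho>)\<^sup>2" by simp
    then have "(2 - \<rho>) * \<rho> \<le> 1" by (simp add: power2_eq_square algebra_simps)
    then show "(1 + \<kappa>) * \<rho> \<le> \<kappa>"
      using \<rho> by (simp add: \<kappa>_def divide_simps)
  qed
  have m: "0 < m" using b by (simp add: m_def)
  have \<delta>: "m \<le> \<delta> n" for n
  proof (cases "0 \<le> b")
    case True
    have "q ^ Suc n \<le> q" using pow_le_1[of n] q by simp
    then have "b * q ^ Suc n \<le> b * q" using True by (rule mult_left_mono)
    then show ?thesis by (simp add: \<delta>_def m_def mult_ac)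
  next
    case False
    then have "b * q ^ Suc n \<le> 0" using pow_pos[of "Suc n"] by (simp add: mult_nonpos_nonneg)
    then show ?thesis by (simp add: \<delta>_def m_def)
  qed
  have up\<delta>: "complex_of_real (up n) = t * of_real (\<delta> n)" for n
    by (simp add: up_def \<delta>_def t_def)
  have rec: "s * of_real (\<delta> n) * g (Suc n) = (s + t / s - p ^ n * (A + B)) * g n - (1 - p ^ n) * (t / s) * g (n - 1)" for n
  proof -
    have "of_real (up n) * pol (Suc n) * (t / s) ^ n
        = (s + t / s - p ^ n * (A + B)) * g n - (1 - p ^ n) * (pol (n - 1) * (t / s) ^ n)"
      unfolding pol_Suc g_def by (simp add: left_diff_distrib mult.assoc)
    moreover have "(1 - p ^ n) * (pol (n - 1) * (t / s) ^ n) = (1 - p ^ n) * (t / s) * g (n - 1)"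
      by (cases n) (simp_all add: g_def)
    moreover have "of_real (up n) * pol (Suc n) * (t / s) ^ n = s * of_real (\<delta> n) * g (Suc n)"
      unfolding up\<delta> g_def using s_nz t_nz by (simp add: field_simps)
    ultimately show ?thesis by simp
  qed
  define C where "C = \<bar>b\<bar> * q / m + (cmod (s * of_real b * p) + cmod (A + B) + cmod (t / s)) / (cmod s * m)"
  have C0: "0 \<le> C"
    using m q by (auto simp: C_def intro!: add_nonneg_nonneg divide_nonneg_nonneg)
  have step: "cmod (\<Delta> (Suc n)) \<le> \<rho> * cmod (\<Delta> n) + C * q ^ n * (cmod (g n) + cmod (\<Delta> n))" for n
  proof -
    \<comment> \<open>All contributions with a factor \<open>p ^ n\<close>: from
      \<open>\<delta> n\<close>, from \<open>A + B\<close>, and from the lower coefficient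
      \<open>1 - p ^ n\<close>.\<close>
    define X where "X = s * of_real b * p * g n - (A + B) * g n + (t / s) * g (n - 1)"
    have \<delta>0: "0 < \<delta> n" using \<delta>[of n] m by linarith
    have "s * of_real (\<delta> n) * \<Delta> (Suc n) = (t / s) * \<Delta> n + p ^ n * X"
      using rec[of n] by (simp add: \<Delta>_def X_def \<delta>_def p_def algebra_simps)
    then have "\<Delta> (Suc n) = ((t / s) * \<Delta> n + p ^ n * X) / (s * of_real (\<delta> n))"
      using s_nz \<delta>0 by (simp add: field_simps)
    also have "\<dots> = t / s\<^sup>2 * \<Delta> n / of_real (\<delta> n) + p ^ n * X / (s * of_real (\<delta> n))"
      by (simp add: add_divide_distrib power2_eq_square)
    finally have "cmod (\<Delta> (Suc n)) \<le> cmod (t / s\<^sup>2 * \<Delta> n / of_real (\<delta> n)) + cmod (p ^ n * X / (s * of_real (\<delta> n)))"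
      using norm_triangle_ineq by metis
    also have "cmod (t / s\<^sup>2 * \<Delta> n / of_real (\<delta> n)) \<le> \<rho> * cmod (\<Delta> n) + (\<bar>b\<bar> * q / m) * q ^ n * cmod (\<Delta> n)"
    proof -
      have "cmod (t / s\<^sup>2 * \<Delta> n / of_real (\<delta> n)) = \<rho> * cmod (\<Delta> n) * (1 / \<delta> n)"
        unfolding norm_divide[of _ "of_real (\<delta> n)"] norm_mult[of "t / s\<^sup>2"] norm_ratio \<rho>_def
        using \<delta>0 by simp
      also have "1 / \<delta> n = 1 + b * q ^ Suc n / \<delta> n"
        using \<delta>0 by (simp add: \<delta>_def field_simps)
      also have "b * q ^ Suc n / \<delta> n \<le> \<bar>b\<bar> * q ^ Suc n / m"
        using \<delta>[of n] m q by (intro frac_le mult_right_mono) auto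
      also have "\<rho> * cmod (\<Delta> n) * (1 + \<bar>b\<bar> * q ^ Suc n / m) =
          \<rho> * cmod (\<Delta> n) + \<rho> * ((\<bar>b\<bar> * q / m) * q ^ n * cmod (\<Delta> n))"
        by (simp add: algebra_simps)
      also have "\<rho> * ((\<bar>b\<bar> * q / m) * q ^ n * cmod (\<Delta> n)) \<le> 1 * ((\<bar>b\<bar> * q / m) * q ^ n * cmod (\<Delta> n))"
        using \<rho> q m by (intro mult_right_mono) auto
      finally show ?thesis
        using \<rho> by (simp add: mult_left_mono)
    qed
    also have "cmod (p ^ n * X / (s * of_real (\<delta> n))) \<le>
        (cmod (s * of_real b * p) + cmod (A + B) + cmod (t / s)) / (cmod s * m) * q ^ n * (cmod (g n) + cmod (\<Delta> n))"
    proof -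
      define G where "G = cmod (g n) + cmod (\<Delta> n)"
      have G: "cmod (g n) \<le> G" "cmod (g (n - 1)) \<le> G"
        using norm_triangle_ineq4[of "g n" "\<Delta> n"] by (auto simp: G_def \<Delta>_def)
      have "cmod X \<le> cmod (s * of_real b * p) * cmod (g n) + cmod (A + B) * cmod (g n) + cmod (t / s) * cmod (g (n - 1))"
        unfolding X_def norm_mult[of _ "g _", symmetric]
        by (intro order_trans[OF norm_triangle_ineq] order_trans[OF norm_triangle_ineq4] add_mono order_refl)
      also have "\<dots> \<le> cmod (s * of_real b * p) * G + cmod (A + B) * G + cmod (t / s) * G"
        using G by (intro add_mono mult_left_mono) auto
      finally have X: "cmod X \<le> (cmod (s * of_real b * p) + cmod (A + B) + cmod (t / s)) * G"
        by (simp add: algebra_simps)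
      have "cmod (p ^ n * X / (s * of_real (\<delta> n))) = q ^ n * cmod X / (cmod s * \<delta> n)"
        using \<delta>0 q by (simp add: norm_mult norm_divide norm_power norm_p)
      also have "\<dots> \<le> q ^ n * ((cmod (s * of_real b * p) + cmod (A + B) + cmod (t / s)) * G) / (cmod s * m)"
        using X q s_nz m \<delta>[of n]
        by (intro frac_le mult_left_mono mult_nonneg_nonneg order_trans[OF norm_ge_zero X]) (auto intro: mult_pos_pos)
      finally show ?thesis by (simp add: G_def mult_ac)
    qed
    also have "(\<bar>b\<bar> * q / m) * q ^ n * cmod (\<Delta> n) \<le> (\<bar>b\<bar> * q / m) * q ^ n * (cmod (g n) + cmod (\<Delta> n))"
      using q m by (intro mult_left_mono) auto
    finally show ?thesis
      by (simp add: C_def distrib_right)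
  qed
  define N where "N n = cmod (g n) + \<kappa> * cmod (\<Delta> n)" for n
  have "N (Suc n) \<le> (1 + ((1 + \<kappa>) * C) * q ^ n) * N n" for n
  proof -
    have "cmod (g (Suc n)) \<le> cmod (g n) + cmod (\<Delta> (Suc n))"
      using norm_triangle_ineq[of "g n" "\<Delta> (Suc n)"] by (simp add: \<Delta>_def)
    then have "N (Suc n) \<le> cmod (g n) + (1 + \<kappa>) * cmod (\<Delta> (Suc n))"
      by (simp add: N_def algebra_simps)
    also have "\<dots> \<le> cmod (g n) + (1 + \<kappa>) * (\<rho> * cmod (\<Delta> n) + C * q ^ n * (cmod (g n) + cmod (\<Delta> n)))"
      using \<kappa> by (intro add_left_mono mult_left_mono step) auto
    also have "\<dots> = cmod (g n) + (1 + \<kappa>) * \<rho> * cmod (\<Delta> n) + (1 + \<kappa>) * C * q ^ n * (cmod (g n) + cmod (\<Delta> n))"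
      by (simp add: algebra_simps)
    also have "\<dots> \<le> cmod (g n) + \<kappa> * cmod (\<Delta> n) + (1 + \<kappa>) * C * q ^ n * N n"
    proof (intro add_mono mult_left_mono mult_right_mono order_refl)
      have "1 * cmod (\<Delta> n) \<le> \<kappa> * cmod (\<Delta> n)"
        by (intro mult_right_mono \<kappa>) auto
      then show "cmod (g n) + cmod (\<Delta> n) \<le> N n" by (simp add: N_def)
    qed (use \<kappa> C0 q in auto)
    finally show ?thesis by (simp add: N_def algebra_simps)
  qed
  then obtain M where M: "\<And>n. N n \<le> M"
    using discrete_gronwall_geometric[of q "(1 + \<kappa>) * C" N] q \<kappa> C0 by (force simp: N_def)
  have "cmod (g n) \<le> M" for n
  proof -
    have "0 \<le> \<kappa> * cmod (\<Delta> n)" using \<kappa> by simp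
    then show ?thesis using M[of n] by (simp add: N_def)
  qed
  then show ?thesis unfolding g_def by (rule that)
qed

lemma pol_bound: obtains K where "0 < K" "\<And>n. sqrt (w n) * cmod (pol n) \<le> K / r ^ n"
proof -
  obtain M where M: "\<And>n. cmod (pol n * (t / s) ^ n) \<le> M"
    using rescaled_pol_bounded by metis
  obtain u where u: "0 < u" "\<And>k. sqrt (w k) \<le> u * sqrt (a * q) ^ k"
    using sqrt_w_bounds by metis
  have ts: "cmod (t / s) = sqrt (a * q) * r"
    using a q by (simp add: t_def r_def norm_divide norm_mult)
  show ?thesis
  proof
    show "0 < u * (\<bar>M\<bar> + 1)" using u by simp
    fix n
    have "cmod (pol n) * (sqrt (a * q) * r) ^ n \<le> \<bar>M\<bar> + 1"
      using M[of n] unfolding norm_mult norm_power ts by linarith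
    then have "cmod (pol n) * sqrt (a * q) ^ n \<le> (\<bar>M\<bar> + 1) / r ^ n"
      using r by (simp add: power_mult_distrib field_simps)
    then have "u * (cmod (pol n) * sqrt (a * q) ^ n) \<le> u * ((\<bar>M\<bar> + 1) / r ^ n)"
      using u by (intro mult_left_mono) auto
    moreover have "sqrt (w n) * cmod (pol n) \<le> u * sqrt (a * q) ^ n * cmod (pol n)"
      by (intro mult_right_mono u) auto
    ultimately show "sqrt (w n) * cmod (pol n) \<le> u * (\<bar>M\<bar> + 1) / r ^ n"
      by (simp add: mult_ac)
  qed
qed

end

subsection \<open>The Green function\<close>

context q_jacobi_resolvent
begin

text \<open>The weighted Wronskian is constant by \<open>w_Suc\<close>. Its value is read off at
  index \<open>0\<close>, where \<psi> misses the equation by \<open>s * D\<close>.\<close>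

lemma wronskian: "of_real (w n * up n) * (pol n * \<psi> (Suc n) - pol (Suc n) * \<psi> n) = - (s * D)"
proof (induction n)
  case 0
  have "pol 0 * (T \<psi> 0 - z * \<psi> 0) - (T pol 0 - z * pol 0) * \<psi> 0 = s * D"
    unfolding \<psi>_solution pol_solution by simp
  then show ?case
    unfolding T_minus_z by (simp add: w_0 algebra_simps)
next
  case (Suc n)
  have "pol (Suc n) * (T \<psi> (Suc n) - z * \<psi> (Suc n)) - (T pol (Suc n) - z * pol (Suc n)) * \<psi> (Suc n) = 0"
    unfolding \<psi>_solution pol_solution by simp
  then have *: "of_real (up (Suc n)) * (pol (Suc n) * \<psi> (Suc (Suc n)) - pol (Suc (Suc n)) * \<psi> (Suc n))
      = (1 - p ^ Suc n) * (pol n * \<psi> (Suc n) - pol (Suc n) * \<psi> n)"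
    unfolding T_minus_z by (simp add: algebra_simps)
  have "of_real (w (Suc n) * up (Suc n)) * (pol (Suc n) * \<psi> (Suc (Suc n)) - pol (Suc (Suc n)) * \<psi> (Suc n))
    = of_real (w (Suc n)) * (of_real (up (Suc n)) * (pol (Suc n) * \<psi> (Suc (Suc n)) - pol (Suc (Suc n)) * \<psi> (Suc n)))"
    by (simp add: mult.assoc)
  also have "\<dots> = of_real (w (Suc n) * (1 - q ^ Suc n)) * (pol n * \<psi> (Suc n) - pol (Suc n) * \<psi> n)"
    unfolding * by (simp add: p_def mult.assoc)
  finally show ?case
    unfolding w_Suc Suc.IH .
qed

text \<open>The kernel is \<open>pol\<close> at the smaller index times \<psi> at the larger one,
  with the weight. It is not yet divided by \<open>s * D\<close>, so it makes sense for every
  \<open>D\<close>.\<close>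

definition green :: "(nat \<Rightarrow> complex) \<Rightarrow> nat \<Rightarrow> complex" where
  "green f n = \<psi> n * (\<Sum>m\<le>n. pol m * of_real (w m) * f m)
    + pol n * (\<Sum>m. \<psi> (m + Suc n) * of_real (w (m + Suc n)) * f (m + Suc n))"

lemma \<psi>_L2w: "\<psi> \<in> L2w w"
proof -
  obtain K where "\<And>n. sqrt (w n) * cmod (\<psi> n) \<le> K * r ^ n" using \<psi>_bound by metis
  then show ?thesis using r by (intro L2w_geometric[where r = r]) auto
qed

lemma green_summable:
  assumes f: "f \<in> L2w w"
  shows "summable (\<lambda>m. \<psi> (m + k) * of_real (w (m + k)) * f (m + k))"
proof -
  have "summable (\<lambda>m. cmod (\<psi> m * of_real (w m) * f m))"
    using inner2_summable[OF w_nonneg \<psi>_L2w f] w_nonneg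
    by (simp add: norm_mult mult_ac)
  then have "summable (\<lambda>m. \<psi> m * of_real (w m) * f m)"
    by (rule summable_norm_cancel)
  then show ?thesis
    by (rule summable_ignore_initial_segment)
qed

lemma green_linear:
  assumes f: "f \<in> L2w w" and g: "g \<in> L2w w"
  shows "green (\<lambda>k. x * f k + y * g k) = (\<lambda>k. x * green f k + y * green g k)"
proof
  fix n
  let ?F = "\<lambda>m. \<psi> (m + Suc n) * of_real (w (m + Suc n)) * f (m + Suc n)"
  let ?G = "\<lambda>m. \<psi> (m + Suc n) * of_real (w (m + Suc n)) * g (m + Suc n)"
  have "(\<Sum>m. \<psi> (m + Suc n) * of_real (w (m + Suc n)) * (x * f (m + Suc n) + y * g (m + Suc n)))
      = (\<Sum>m. x * ?F m + y * ?G m)"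
    by (simp only: distrib_left mult_ac)
  also have "\<dots> = x * suminf ?F + y * suminf ?G"
    using green_summable[OF f, of "Suc n"] green_summable[OF g, of "Suc n"]
    by (simp only: suminf_add[symmetric] suminf_mult summable_mult)
  finally show "green (\<lambda>k. x * f k + y * g k) n = x * green f n + y * green g n"
    unfolding green_def by (simp add: sum.distrib sum_distrib_left algebra_simps)
qed

lemma T_green:
  assumes f: "f \<in> L2w w"
  shows "T (green f) n - z * green f n = s * D * f n"
proof -
  define P where "P n = (\<Sum>m\<le>n. pol m * of_real (w m) * f m)" for n
  define Q where "Q n = (\<Sum>m. \<psi> (m + Suc n) * of_real (w (m + Suc n)) * f (m + Suc n))" for n
  have green: "green f n = \<psi> n * P n + pol n * Q n" for n
    by (simp add: green_def P_def Q_def)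
  have P: "P (Suc n) = P n + pol (Suc n) * of_real (w (Suc n)) * f (Suc n)" for n
    by (simp add: P_def)
  have Q: "Q n = \<psi> (Suc n) * of_real (w (Suc n)) * f (Suc n) + Q (Suc n)" for n
    using suminf_split_head[OF green_summable[OF f, of "Suc n"]] by (simp add: Q_def)
  \<comment> \<open>No correction appears at the upper neighbour: the summand with
    \<open>m = n + 1\<close> has the same kernel value in either sum.\<close>
  have up: "green f (Suc n) = \<psi> (Suc n) * P n + pol (Suc n) * Q n" for n
    unfolding green P Q[of n] by (simp add: algebra_simps)
  show ?thesis
  proof (cases n)
    case 0
    have "T (green f) 0 - z * green f 0 = P 0 * (T \<psi> 0 - z * \<psi> 0) + Q 0 * (T pol 0 - z * pol 0)"
      unfolding T_minus_z up by (simp add: green algebra_simps)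
    then show ?thesis
      unfolding \<psi>_solution pol_solution 0 by (simp add: P_def w_0)
  next
    case (Suc k)
    \<comment> \<open>At the lower neighbour moving the summand \<open>m = n\<close> costs a
      Wronskian, which produces the source term. For \<open>n = 0\<close> the source came from the
      defect of \<psi> instead.\<close>
    have down: "green f k = \<psi> k * P n + pol k * Q n
        + (pol k * \<psi> n - pol n * \<psi> k) * (of_real (w n) * f n)"
      unfolding green P Q[of k] Suc by (simp add: algebra_simps)
    have nk: "n - 1 = k" by (simp add: Suc)
    have "T (green f) n - z * green f n = P n * (T \<psi> n - z * \<psi> n) + Q n * (T pol n - z * pol n)
        - (1 - p ^ n) * ((pol k * \<psi> n - pol n * \<psi> k) * (of_real (w n) * f n))"
      unfolding T_minus_z[of "green f" n] T_minus_z[of \<psi> n] T_minus_z[of pol n]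
      unfolding nk up down green[of n] by (simp add: algebra_simps)
    also have "\<dots> = - (of_real (w n * (1 - q ^ n)) * (pol k * \<psi> n - pol n * \<psi> k)) * f n"
      unfolding \<psi>_solution pol_solution by (simp add: Suc p_def)
    also have "\<dots> = s * D * f n"
      unfolding Suc w_Suc wronskian by simp
    finally show ?thesis .
  qed
qed

text \<open>Splitting the weight evenly between kernel and \<open>f\<close> leaves a kernel bounded
  by \<open>K\<close> times \<open>r\<close> to the distance of the indices. Its two halves
  \<open>u\<close> and \<open>v\<close> obey the forward and backward recurrences estimated
  earlier.\<close>

lemma green_bounded:
  obtains C where "\<And>f. f \<in> L2w w \<Longrightarrow> green f \<in> L2w w \<and> norm2 w (green f) \<le> C * norm2 w f"
proof -
  obtain K1 where K1: "0 < K1" "\<And>n. sqrt (w n) * cmod (\<psi> n) \<le> K1 * r ^ n"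
    using \<psi>_bound by metis
  obtain K2 where K2: "0 < K2" "\<And>n. sqrt (w n) * cmod (pol n) \<le> K2 / r ^ n"
    using pol_bound by metis
  define K where "K = K1 * K2"
  have K: "0 < K" using K1 K2 by (simp add: K_def)
  define C where "C = K * (1 / (1 - r)) + K * ((r / (1 - r) + 1) / (1 - r))"
  have main: "L2_set (\<lambda>k. sqrt (w k) * cmod (green f k)) {..<N} \<le> C * norm2 w f"
    if f: "f \<in> L2w w" for f N
  proof -
    define H where "H = norm2 w f"
    define h where "h k = sqrt (w k) * cmod (f k)" for k
    define u where "u n = (\<Sum>m\<le>n. r ^ (n - m) * h m)" for n
    define v where "v n = (\<Sum>m. r ^ Suc m * h (m + Suc n))" for n
    have h0: "0 \<le> h k" for k using w_nonneg by (simp add: h_def)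
    have hH: "h k \<le> H" for k unfolding h_def H_def by (rule L2w_component_le[OF w_nonneg f])
    have H0: "0 \<le> H" using h0[of 0] hH[of 0] by linarith
    have hN: "L2_set h {..<N} \<le> H" for N
      unfolding h_def[abs_def] H_def using w_nonneg f by (rule L2_set_le_norm2)
    have u0: "0 \<le> u n" for n unfolding u_def using r h0 by (intro sum_nonneg) auto
    have usuc: "u (Suc n) = r * u n + h (Suc n)" for n
      by (simp add: u_def sum_distrib_left Suc_diff_le mult_ac)
    have sr: "summable (\<lambda>m. r ^ Suc m * H)"
      using r by (intro summable_mult2 summable_Suc_iff[THEN iffD2] summable_geometric) auto
    have sv: "summable (\<lambda>m. r ^ Suc m * h (m + Suc n))" for n
      by (rule summable_comparison_test'[OF sr]) (use r h0 hH in \<open>auto simp: abs_mult intro!: mult_left_mono\<close>)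
    have v0: "0 \<le> v n" for n unfolding v_def using r h0 by (intro suminf_nonneg sv) auto
    have vV: "v n \<le> r / (1 - r) * H" for n
    proof -
      have "v n \<le> (\<Sum>m. r ^ Suc m * H)"
        unfolding v_def using r hH by (intro suminf_le sv sr mult_left_mono) auto
      also have "\<dots> = (\<Sum>m. (r * H) * r ^ m)"
        by (simp add: mult_ac)
      also have "\<dots> = r / (1 - r) * H"
        using r by (subst suminf_mult) (auto intro: summable_geometric simp: suminf_geometric)
      finally show ?thesis .
    qed
    have vrec: "v n = r * (v (Suc n) + h (Suc n))" for n
    proof -
      have "v n = r * h (Suc n) + (\<Sum>m. r ^ Suc (Suc m) * h (Suc m + Suc n))"
        using suminf_split_head[OF sv[of n]] by (simp add: v_def)
      also have "(\<Sum>m. r ^ Suc (Suc m) * h (Suc m + Suc n)) = (\<Sum>m. r * (r ^ Suc m * h (m + Suc (Suc n))))"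
        by (simp add: mult_ac)
      also have "\<dots> = r * v (Suc n)"
        unfolding v_def by (rule suminf_mult[OF sv])
      finally show ?thesis by (simp add: algebra_simps)
    qed
    have pt: "sqrt (w n) * cmod (green f n) \<le> K * u n + K * v n" for n
    proof -
      have norm_weighted: "cmod (x * of_real (w m) * f m) = (sqrt (w m) * cmod x) * h m" for x m
      proof -
        have "cmod (x * of_real (w m) * f m) = cmod x * (sqrt (w m) * sqrt (w m)) * cmod (f m)"
          using w_nonneg[of m] by (simp add: norm_mult)
        then show ?thesis by (simp add: h_def mult_ac)
      qed
      have "cmod (\<Sum>m\<le>n. pol m * of_real (w m) * f m) \<le> (\<Sum>m\<le>n. K2 / r ^ m * h m)"
        by (intro sum_norm_le) (simp only: norm_weighted, intro mult_right_mono K2 h0)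
      then have "(sqrt (w n) * cmod (\<psi> n)) * cmod (\<Sum>m\<le>n. pol m * of_real (w m) * f m)
          \<le> (K1 * r ^ n) * (\<Sum>m\<le>n. K2 / r ^ m * h m)"
        by (rule mult_mono[OF K1(2)]) (use K1 r in auto)
      also have "\<dots> = K * u n"
        unfolding u_def K_def sum_distrib_left
        using r by (intro sum.cong) (auto simp: power_diff field_simps)
      finally have 1: "sqrt (w n) * cmod (\<psi> n * (\<Sum>m\<le>n. pol m * of_real (w m) * f m)) \<le> K * u n"
        by (simp add: norm_mult mult.assoc)
      let ?F = "\<lambda>m. \<psi> (m + Suc n) * of_real (w (m + Suc n)) * f (m + Suc n)"
      have Fle: "cmod (?F m) \<le> (K1 * r ^ n) * (r ^ Suc m * h (m + Suc n))" for m
      proof -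
        have "cmod (?F m) \<le> (K1 * r ^ (m + Suc n)) * h (m + Suc n)"
          unfolding norm_weighted by (intro mult_right_mono K1 h0)
        then show ?thesis by (simp add: power_add mult_ac)
      qed
      have "cmod (suminf ?F) \<le> (\<Sum>m. (K1 * r ^ n) * (r ^ Suc m * h (m + Suc n)))"
        by (rule norm_suminf_le[OF Fle summable_mult[OF sv]])
      also have "\<dots> = (K1 * r ^ n) * v n"
        unfolding v_def by (rule suminf_mult[OF sv])
      finally have "(sqrt (w n) * cmod (pol n)) * cmod (suminf ?F) \<le> (K2 / r ^ n) * ((K1 * r ^ n) * v n)"
        by (rule mult_mono[OF K2(2)]) (use K2 r in auto)
      also have "\<dots> = K * v n"
        using r by (simp add: K_def)
      finally have 2: "sqrt (w n) * cmod (pol n * suminf ?F) \<le> K * v n"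
        by (simp add: norm_mult mult.assoc)
      have "sqrt (w n) * cmod (green f n) \<le> sqrt (w n) * (cmod (\<psi> n * (\<Sum>m\<le>n. pol m * of_real (w m) * f m)) + cmod (pol n * suminf ?F))"
        unfolding green_def using w_nonneg by (intro mult_left_mono norm_triangle_ineq) auto
      then show ?thesis
        using 1 2 by (simp only: distrib_left)
    qed
    have "L2_set (\<lambda>k. sqrt (w k) * cmod (green f k)) {..<N} \<le> L2_set (\<lambda>k. K * u k + K * v k) {..<N}"
      using pt w_nonneg by (intro L2_set_mono) auto
    also have "\<dots> \<le> K * L2_set u {..<N} + K * L2_set v {..<N}"
      using L2_set_triangle_ineq K by (simp add: L2_set_right_distrib)
    also have "L2_set u {..<N} \<le> L2_set h {..<N} / (1 - r)"
      by (rule L2_set_forward_recurrence_le[where r = r and u = u and h = h, OF _ _ u0 h0 _ usuc]) (use r in \<open>auto simp: u_def\<close>)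
    also have "\<dots> \<le> H / (1 - r)"
      using hN r by (intro divide_right_mono) auto
    also have "L2_set v {..<N} \<le> (r / (1 - r) * H + H) / (1 - r)"
      by (rule L2_set_backward_recurrence_le[where r = r and v = v and h = h, OF _ _ v0 vV h0 hN vrec]) (use r in auto)
    finally have "L2_set (\<lambda>k. sqrt (w k) * cmod (green f k)) {..<N}
        \<le> K * (H / (1 - r)) + K * ((r / (1 - r) * H + H) / (1 - r))"
      using K by (simp add: mult_left_mono)
    also have "\<dots> = C * H"
      by (simp add: C_def add_divide_distrib distrib_right)
    finally show ?thesis by (simp add: H_def)
  qed
  show ?thesis
    using that L2w_I[OF w_nonneg main] by blast
qed

lemma green_L2w: "f \<in> L2w w \<Longrightarrow> green f \<in> L2w w"
  using green_bounded by metis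

text \<open>A solution \<open>f\<close> of the homogeneous equation is orthogonal to the range of \<open>T - cnj z\<close>, which
  contains every point mass.\<close>

lemma T_minus_z_injective:
  assumes D: "D \<noteq> 0" and f: "f \<in> L2w w" and eq: "\<And>k. T f k = z * f k"
  shows "f n = 0"
proof -
  define d where "d k = (if k = n then 1 else 0 :: complex)" for k
  have d: "d \<in> L2w w"
    by (rule L2w_finite_support(1)[of "Suc n"]) (simp add: d_def)
  define g where "g = green d"
  have g: "g \<in> L2w w" unfolding g_def by (rule green_L2w[OF d])
  have Tg: "T g k = z * g k + s * D * d k" for k
    using T_green[OF d, of k] by (simp add: g_def algebra_simps)
  \<comment> \<open>As \<open>T\<close> has real coefficients, conjugating \<open>g\<close> gives an
    equation with \<open>cnj z\<close>; the conjugation inside \<open>inner2\<close> turns it back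
    into the one for \<open>z\<close>.\<close>
  define g' where "g' k = cnj (g k)" for k
  have g': "g' \<in> L2w w" using g by (simp add: L2w_def g'_def)
  have Tg': "cnj (T g' k) = T g k" for k
    using T_cnj[of g k] by (simp add: g'_def[abs_def])
  have "inner2 w (T f) g' = inner2 w f (T g')"
    using self_adjoint_T f g' by (simp add: self_adjoint_on_def)
  then have "(\<lambda>k. of_real (w k) * f k * cnj (T g' k) - of_real (w k) * T f k * cnj (g' k)) sums 0"
    using sums_diff[OF inner2_sums[OF w_nonneg f T_L2w[OF g']] inner2_sums[OF w_nonneg T_L2w[OF f] g']]
    by simp
  moreover have "of_real (w k) * f k * cnj (T g' k) - of_real (w k) * T f k * cnj (g' k)
      = (if k = n then of_real (w n) * f n * (s * D) else 0)" for k
    unfolding Tg' Tg eq by (simp add: g'_def d_def algebra_simps)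
  ultimately have "(\<lambda>k. if k = n then of_real (w n) * f n * (s * D) else 0) sums 0"
    by simp
  then have "of_real (w n) * f n * (s * D) = 0"
    by (rule sums_unique2[OF sums_single[of n "\<lambda>k. of_real (w n) * f n * (s * D)"]])
  then show ?thesis
    using w_pos[of n] D s_nz by simp
qed

text \<open>The scaled Green operator is a right inverse. It is also a left inverse, since
  \<open>S\<close> applied to \<open>T f - z f\<close>, minus \<open>f\<close>, is a square summable
  homogeneous solution and hence zero.\<close>

lemma resolvent_set:
  assumes D: "D \<noteq> 0"
  shows "z \<notin> spectrum_on w T"
proof -
  define S where "S f k = 1 / (s * D) * green f k" for f k
  have S_eq: "S f = (\<lambda>k. 1 / (s * D) * green f k)" for f
    by (simp add: S_def fun_eq_iff)
  have S_L2: "S f \<in> L2w w" if "f \<in> L2w w" for f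
    unfolding S_eq using green_L2w[OF that] by (intro L2w_cmult w_nonneg)
  obtain C where C: "\<And>f. f \<in> L2w w \<Longrightarrow> green f \<in> L2w w \<and> norm2 w (green f) \<le> C * norm2 w f"
    using green_bounded by metis
  have "bounded_op_on w S"
    unfolding bounded_op_on_def
  proof (intro conjI ballI allI exI)
    fix f g x y assume "f \<in> L2w w" "g \<in> L2w w"
    then show "S (\<lambda>k. x * f k + y * g k) = (\<lambda>k. x * S f k + y * S g k)"
      by (simp add: S_def[abs_def] green_linear fun_eq_iff add_divide_distrib)
  next
    fix f assume f: "f \<in> L2w w"
    have "norm2 w (S f) \<le> cmod (1 / (s * D)) * norm2 w (green f)"
      unfolding S_eq using green_L2w[OF f] by (intro L2w_cmult w_nonneg)
    also have "\<dots> \<le> cmod (1 / (s * D)) * (C * norm2 w f)"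
      using C[OF f] by (intro mult_left_mono) auto
    finally show "norm2 w (S f) \<le> (cmod (1 / (s * D)) * C) * norm2 w f"
      by (simp only: mult.assoc)
  qed (rule S_L2)
  moreover have TS: "T (S f) k - z * S f k = f k" if f: "f \<in> L2w w" for f k
  proof -
    have "T (S f) k = 1 / (s * D) * T (green f) k"
      unfolding S_eq using T_linear[of "1 / (s * D)" "green f" 0 "green f"] by (simp add: fun_eq_iff)
    then have "T (S f) k - z * S f k = 1 / (s * D) * (T (green f) k - z * green f k)"
      by (simp add: S_def algebra_simps)
    then show ?thesis
      using T_green[OF f] D s_nz by simp
  qed
  moreover have "S (\<lambda>k. T f k - z * f k) = f" if f: "f \<in> L2w w" for f
  proof -
    define g where "g = (\<lambda>k. 1 * T f k + (- z) * f k)"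
    have g: "g \<in> L2w w"
      unfolding g_def using T_L2w[OF f] f by (intro L2w_add(1) L2w_cmult(1) w_nonneg)
    define h where "h = (\<lambda>k. 1 * S g k + (- 1) * f k)"
    have h: "h \<in> L2w w"
      unfolding h_def using S_L2[OF g] f by (intro L2w_add(1) L2w_cmult(1) w_nonneg)
    have "T h k = z * h k" for k
    proof -
      have "T h k = T (S g) k - T f k"
        unfolding h_def T_linear by simp
      also have "\<dots> = z * S g k + g k - T f k"
        using TS[OF g, of k] by (simp add: algebra_simps)
      also have "\<dots> = z * h k"
        by (simp add: g_def h_def algebra_simps)
      finally show ?thesis .
    qed
    then have "h k = 0" for k
      by (rule T_minus_z_injective[OF D h])
    then have "S g = f"
      by (simp add: h_def fun_eq_iff)
    then show ?thesis by (simp add: g_def)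
  qed
  ultimately have "\<exists>S. bounded_op_on w S \<and>
       (\<forall>f\<in>L2w w. S (\<lambda>k. T f k - z * f k) = f \<and> (\<lambda>k. T (S f) k - z * S f k) = f)"
    by (intro exI[of _ S]) auto
  then show ?thesis
    by (simp add: spectrum_on_def)
qed

end

subsection \<open>The spectrum\<close>

text \<open>The two roots of the quadratic have product \<open>t\<close>; choosing the larger one
  reduces every spectral parameter to \<open>cmod s\<close> at least
  \<open>sqrt (a * q)\<close>.\<close>

lemma quadratic_root_pair:
  fixes u t :: complex
  assumes "t \<noteq> 0"
  obtains s where "s \<noteq> 0" "u = s + t / s" "cmod (t / s) \<le> cmod s"
proof -
  obtain d where d: "d\<^sup>2 = u\<^sup>2 - 4 * t"
    using power2_csqrt by metis
  define x y where "x = (u + d) / 2" and "y = (u - d) / 2"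
  have xy: "x * y = t" "x + y = u"
    using d by (simp_all add: x_def y_def field_simps power2_eq_square)
  then have nz: "x \<noteq> 0" "y \<noteq> 0" using assms by auto
  have q: "t / x = y" "t / y = x"
    using xy nz by (auto simp: field_simps)
  consider "cmod y \<le> cmod x" | "cmod x \<le> cmod y" by linarith
  then show ?thesis
  proof cases
    case 1
    then show ?thesis using that[of x] nz q xy by simp
  next
    case 2
    then show ?thesis using that[of y] nz q xy by (simp add: add.commute)
  qed
qed

context q_jacobi
begin

lemma spectrum_T:
  "spectrum_on w T = complex_of_real ` {(1 - sqrt (a * q))\<^sup>2 .. (1 + sqrt (a * q))\<^sup>2}
    \<union> {1 + of_real (a * q) - s - of_real (a * q) / s | s.
        sqrt (a * q) < cmod s \<and> (\<exists>k. s = A * of_real (q ^ k) \<or> s = B * of_real (q ^ k))}"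
  (is "_ = ?I \<union> ?E")
proof (intro equalityI subsetI)
  define \<rho> where "\<rho> = sqrt (a * q)"
  have \<rho>: "0 < \<rho>" "\<rho>\<^sup>2 = a * q" using a q by (auto simp: \<rho>_def)
  \<comment> \<open>On the circle the spectral parameter therefore equals
    \<open>1 + a * q - 2 * Re s\<close>, which sweeps out the interval.\<close>
  have circle: "of_real (a * q) / s = cnj s" if "cmod s = \<rho>" for s
  proof -
    have "s * cnj s = of_real (a * q)"
      using that \<rho> by (simp only: complex_norm_square[symmetric])
    moreover have "s \<noteq> 0" using that \<rho> by auto
    ultimately show ?thesis by (simp add: field_simps)
  qed
  have interval: "{(1 - sqrt (a * q))\<^sup>2 .. (1 + sqrt (a * q))\<^sup>2} = {1 + a * q - 2 * \<rho> .. 1 + a * q + 2 * \<rho>}"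
    unfolding \<rho>_def[symmetric] using \<rho>(2) by (simp add: power2_eq_square algebra_simps)
  {
    fix z assume z: "z \<in> spectrum_on w T"
    obtain s where s: "s \<noteq> 0" "1 + of_real (a * q) - z = s + of_real (a * q) / s" "cmod (of_real (a * q) / s) \<le> cmod s"
      using quadratic_root_pair[of "of_real (a * q)" "1 + of_real (a * q) - z"] a q by auto
    have z_eq: "z = 1 + of_real (a * q) - s - of_real (a * q) / s"
      using s(2) by (simp add: algebra_simps)
    have "\<rho>\<^sup>2 \<le> (cmod s)\<^sup>2"
      using s a q \<rho> by (simp add: norm_divide norm_mult power2_eq_square field_simps)
    then have "\<rho> \<le> cmod s"
      by (rule power2_le_imp_le) simp
    then consider "cmod s = \<rho>" | "\<rho> < cmod s" by linarith
    then show "z \<in> ?I \<union> ?E"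
    proof cases
      case 1
      have "z = of_real (1 + a * q - 2 * Re s)"
        unfolding z_eq circle[OF 1] by (simp add: complex_eq_iff)
      moreover have "1 + a * q - 2 * Re s \<in> {1 + a * q - 2 * \<rho> .. 1 + a * q + 2 * \<rho>}"
        using abs_Re_le_cmod[of s] 1 by auto
      ultimately show ?thesis unfolding interval by blast
    next
      case 2
      interpret R: q_jacobi_resolvent q a b A B \<gamma> s
        by unfold_locales (use 2 in \<open>simp add: \<rho>_def\<close>)
      have "R.z = z" by (simp add: R.z_def R.t_def z_eq)
      with z R.resolvent_set have "R.D = 0" by auto
      then have "\<exists>k. s = A * of_real (q ^ k) \<or> s = B * of_real (q ^ k)"
        using R.D_eq_0 by (simp add: R.p_def)
      then show ?thesis
        using z_eq 2 unfolding \<rho>_def by blast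
    qed
  }
  fix z assume "z \<in> ?I \<union> ?E"
  then consider x where "z = of_real x" "x \<in> {1 + a * q - 2 * \<rho> .. 1 + a * q + 2 * \<rho>}" | "z \<in> ?E"
    unfolding interval by blast
  then show "z \<in> spectrum_on w T"
  proof cases
    case 1
    \<comment> \<open>The real part that \<open>s\<close> must have; the imaginary part is then
      chosen to put \<open>s\<close> on the circle.\<close>
    define v where "v = (1 + a * q - x) / 2"
    have "\<bar>v\<bar> \<le> \<rho>" using 1 by (auto simp: v_def)
    then have v: "v\<^sup>2 \<le> \<rho>\<^sup>2" using \<rho> by (metis abs_le_square_iff abs_of_pos)
    define s where "s = Complex v (sqrt (\<rho>\<^sup>2 - v\<^sup>2))"
    have s: "cmod s = \<rho>"
      using v \<rho>(1) by (simp add: s_def cmod_def)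
    have "z = 1 + of_real (a * q) - s - of_real (a * q) / s"
      unfolding circle[OF s] using 1 by (simp add: complex_eq_iff s_def v_def)
    then show ?thesis
      using continuous_spectrum s by (simp add: \<rho>_def)
  next
    case 2
    then obtain s k where s: "z = 1 + of_real (a * q) - s - of_real (a * q) / s" "sqrt (a * q) < cmod s"
      "s = A * of_real (q ^ k) \<or> s = B * of_real (q ^ k)"
      by blast
    from s(3) show ?thesis
    proof
      assume "s = A * of_real (q ^ k)"
      then show ?thesis using discrete_spectrum[of A B s k] s by simp
    next
      assume "s = B * of_real (q ^ k)"
      then show ?thesis using discrete_spectrum[of B A s k] s by (simp add: add.commute mult.commute)
    qed
  qed
qed

end

theorem theorem4p1:
  fixes q a b :: real and c \<gamma> :: complex
  assumes "0 < q" "q < 1" "0 < a" "a < 1 / q" "b < 1 / q" "c \<noteq> 0"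
    and "\<gamma> = (1 + complex_of_real (a * b * q\<^sup>2))
              - (complex_of_real (a * q) * c + complex_of_real (b * q) / c)"
    and "Im \<gamma> = 0"
    and "\<forall>n::nat. Im (complex_of_real (1 / q ^ n) * (1 - complex_of_real (a * q ^ (n + 1)) * c)
                     * (1 - complex_of_real (b * q ^ (n + 1)) / c)) = 0
              \<and> Re (complex_of_real (1 / q ^ n) * (1 - complex_of_real (a * q ^ (n + 1)) * c)
                     * (1 - complex_of_real (b * q ^ (n + 1)) / c)) > 0"
  shows "bounded_op_on (wt a b q) (Tgam a b q \<gamma>)
    \<and> self_adjoint_on (wt a b q) (Tgam a b q \<gamma>)
    \<and> simple_spectrum_on (wt a b q) (Tgam a b q \<gamma>)
    \<and> spectrum_on (wt a b q) (Tgam a b q \<gamma>) =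
        complex_of_real ` {(1 - sqrt (a * q))\<^sup>2 .. (1 + sqrt (a * q))\<^sup>2}
      \<union> {(1 - 1 / (complex_of_real (q ^ k) * c)) * (1 - complex_of_real (a * q ^ (1 + k)) * c)
          | k::nat. cmod (complex_of_real (q ^ k) * c * complex_of_real (sqrt (a * q))) > 1}
      \<union> {(1 - complex_of_real (b * q ^ (l + 1)) / c) * (1 - complex_of_real (a / q ^ l) * c / complex_of_real b)
          | l::nat. cmod (complex_of_real (q ^ l * b) / c * complex_of_real (sqrt (q / a))) > 1}"
proof -
  define A where "A = complex_of_real (a * q) * c"
  define B where "B = complex_of_real (b * q) / c"
  interpret q_jacobi q a b A B \<gamma>
    by unfold_locales (use assms in \<open>auto simp: A_def B_def field_simps power2_eq_square\<close>)
  define \<rho> where "\<rho> = sqrt (a * q)"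
  have \<rho>: "0 < \<rho>" "a * q = \<rho> * \<rho>" using a q by (auto simp: \<rho>_def)
  define pt where "pt s = 1 + complex_of_real (a * q) - s - complex_of_real (a * q) / s" for s
  have pt: "pt s = (1 - of_real (a * q) / s) * (1 - s)" if "s \<noteq> 0" for s
    using that by (simp add: pt_def field_simps)
  have cond_A: "\<rho> < cmod (A * of_real (q ^ k)) \<longleftrightarrow>
      cmod (complex_of_real (q ^ k) * c * complex_of_real (sqrt (a * q))) > 1" for k
  proof -
    have "cmod (A * of_real (q ^ k)) = \<rho> * cmod (complex_of_real (q ^ k) * c * complex_of_real (sqrt (a * q)))"
      unfolding A_def \<rho>(2) \<rho>_def[symmetric] using \<rho>(1) by (simp add: norm_mult)
    then show ?thesis using \<rho>(1) by simp
  qed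
  have cond_B: "\<rho> < cmod (B * of_real (q ^ l)) \<longleftrightarrow>
      cmod (complex_of_real (q ^ l * b) / c * complex_of_real (sqrt (q / a))) > 1" for l
  proof -
    have "sqrt (q / a) = q / \<rho>"
      using q a by (simp add: \<rho>_def real_sqrt_divide real_sqrt_mult field_simps)
    then have "cmod (B * of_real (q ^ l)) = \<rho> * cmod (complex_of_real (q ^ l * b) / c * complex_of_real (sqrt (q / a)))"
      unfolding B_def using \<rho>(1) q by (simp add: norm_mult norm_divide)
    then show ?thesis using \<rho>(1) by simp
  qed
  have pt_A: "pt (A * of_real (q ^ k)) =
      (1 - 1 / (complex_of_real (q ^ k) * c)) * (1 - complex_of_real (a * q ^ (1 + k)) * c)" for k
  proof -
    have "A * of_real (q ^ k) \<noteq> 0" using q a assms(6) by (simp add: A_def)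
    moreover have "of_real (a * q) / (A * of_real (q ^ k)) = 1 / (complex_of_real (q ^ k) * c)"
      using q a by (simp add: A_def)
    moreover have "A * of_real (q ^ k) = complex_of_real (a * q ^ (1 + k)) * c"
      by (simp add: A_def)
    ultimately show ?thesis by (simp add: pt)
  qed
  \<comment> \<open>The modulus condition forces \<open>b\<close> to be nonzero, which the division
    by \<open>b\<close> needs; for \<open>b = 0\<close> this part of the spectrum is empty on both
    sides.\<close>
  have pt_B: "pt (B * of_real (q ^ l)) =
      (1 - complex_of_real (b * q ^ (l + 1)) / c) * (1 - complex_of_real (a / q ^ l) * c / complex_of_real b)"
    if "\<rho> < cmod (B * of_real (q ^ l))" for l
  proof -
    have nz: "B * of_real (q ^ l) \<noteq> 0" using that \<rho>(1) by (metis norm_zero less_asym)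
    then have "b \<noteq> 0" by (auto simp: B_def)
    then have "of_real (a * q) / (B * of_real (q ^ l)) = complex_of_real (a / q ^ l) * c / complex_of_real b"
      using q by (simp add: B_def field_simps)
    moreover have "B * of_real (q ^ l) = complex_of_real (b * q ^ (l + 1)) / c"
      by (simp add: B_def)
    ultimately show ?thesis
      using nz by (simp add: pt mult.commute)
  qed
  have "{pt s | s. \<rho> < cmod s \<and> (\<exists>k. s = A * of_real (q ^ k) \<or> s = B * of_real (q ^ k))}
    = {pt (A * of_real (q ^ k)) | k. \<rho> < cmod (A * of_real (q ^ k))}
      \<union> {pt (B * of_real (q ^ l)) | l. \<rho> < cmod (B * of_real (q ^ l))}"
    by blast
  also have "{pt (B * of_real (q ^ l)) | l. \<rho> < cmod (B * of_real (q ^ l))} =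
     {(1 - complex_of_real (b * q ^ (l + 1)) / c) * (1 - complex_of_real (a / q ^ l) * c / complex_of_real b)
       | l. \<rho> < cmod (B * of_real (q ^ l))}"
  proof -
    have "v = pt (B * of_real (q ^ l)) \<and> \<rho> < cmod (B * of_real (q ^ l)) \<longleftrightarrow>
      v = (1 - complex_of_real (b * q ^ (l + 1)) / c) * (1 - complex_of_real (a / q ^ l) * c / complex_of_real b)
        \<and> \<rho> < cmod (B * of_real (q ^ l))" for v l
      using pt_B[of l] by metis
    then show ?thesis by (simp only:)
  qed
  finally have "spectrum_on w T = complex_of_real ` {(1 - sqrt (a * q))\<^sup>2 .. (1 + sqrt (a * q))\<^sup>2}
      \<union> ({(1 - 1 / (complex_of_real (q ^ k) * c)) * (1 - complex_of_real (a * q ^ (1 + k)) * c)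
          | k::nat. cmod (complex_of_real (q ^ k) * c * complex_of_real (sqrt (a * q))) > 1}
      \<union> {(1 - complex_of_real (b * q ^ (l + 1)) / c) * (1 - complex_of_real (a / q ^ l) * c / complex_of_real b)
          | l::nat. cmod (complex_of_real (q ^ l * b) / c * complex_of_real (sqrt (q / a))) > 1})"
    unfolding cond_A cond_B pt_A unfolding spectrum_T pt_def \<rho>_def by simp
  then show ?thesis
    using bounded_op_T self_adjoint_T simple_spectrum_T by (simp only: Un_assoc simp_thms)
qed

end
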